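(* Let $\ell\ge3$. The crystal $B(\Lambda_0)$ is isomorphic to $B(\Lambda_0)^L$.
   Context: An isomorphism here is a bijection between the sets of nodes which preserves the arrows together with their labels $i\in\{0,\dots,\ell-1\}$ in both directions (and the weight, where the weight of a partition $\lambda$ is $\Lambda_0-\sum_i c_i\alpha_i$ with $c_i$ the number of boxes of $\lambda$ of residue $i$). The position $(a,b)$ (row $a$, rows numbered downward; column $b$) has residue $b-a\bmod\ell$. A box of $\lambda$ of residue $i$ whose removal leaves a partition is a removable $i$-box (marked $-$); a position of residue $i$ not in $\lambda$ whose addition gives a partition is an addable $i$-box (marked $+$). Classical crystal $B(\Lambda_0)$ of $\widehat{\mathfrak{sl}_\ell}$: the nodes are the $\ell$-regular partitions (those without $\ell$ or more equal nonzero parts). The $i$-signature is the word of $+$'s and $-$'s read from the bottom row to the top row; after repeatedly deleting adjacent pairs $-+$ one gets $+\cdots+-\cdots-$. $\widetilde f_i\lambda$ is $\lambda$ with the box of the rightmost remaining $+$ added (or $0$ if there is none). There is an $i$-arrow $\lambda\to\mu$ iff $\widetilde f_i\lambda=\mu$. Ladder crystal $B(\Lambda_0)^L$: the ladder of $(a,b)$ is the set of positions $(c,d)$, $c,d\ge1$, with $c-a=(\ell-1)(b-d)$; all its positions have the same residue, and it is an $i$-ladder if that residue is $i$. Ladders are ordered left to right, i.e. by increasing value of $a+(\ell-1)(b-1)$. The ladder $i$-signature of a partition is the word of $+$'s and $-$'s read from leftmost to rightmost $i$-ladder, and from top to bottom on each ladder; repeatedly delete adjacent pairs $-+$. $\widehat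 f_i\lambda$ is $\lambda$ with the box of the rightmost remaining $+$ added (or $0$ if there is none). The nodes of $B(\Lambda_0)^L$ are the partitions obtained from the empty partition $\emptyset$ by applying finite sequences of the operators $\widehat f_i$, and there is an $i$-arrow $\lambda\to\mu$ iff $\widehat f_i\lambda=\mu$. *)

theory Defs
  imports Main "HOL-Library.Product_Lexorder"
begin

section \<open>Partitions\<close>

text \<open>
  A position is a pair \<open>(a, b)\<close> of a row \<open>a \<ge> 1\<close> (numbered downward) and a column \<open>b \<ge> 1\<close>.
  A partition is identified with its Young diagram, the set of positions of its boxes.
\<close>

type_synonym pos = "nat \<times> nat"

definition positions :: "pos set" where
  "positions = {1..} \<times> {1..}"

definition is_partition :: "pos set \<Rightarrow> bool" where
  "is_partition lam \<longleftrightarrow> finite lam \<and> lam \<subseteq> positions \<and>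
     (\<forall>a b c d. (a, b) \<in> lam \<longrightarrow> (c, d) \<in> positions \<longrightarrow> c \<le> a \<longrightarrow> d \<le> b \<longrightarrow> (c, d) \<in> lam)"

definition part :: "pos set \<Rightarrow> nat \<Rightarrow> nat" where
  "part lam a = card {b. (a, b) \<in> lam}"

definition regular :: "nat \<Rightarrow> pos set \<Rightarrow> bool" where
  "regular l lam \<longleftrightarrow> (\<forall>k\<ge>1. card {a. part lam a = k} < l)"

definition residue :: "nat \<Rightarrow> pos \<Rightarrow> nat" where
  "residue l = (\<lambda>(a, b). nat ((int b - int a) mod int l))"

definition removable :: "pos set \<Rightarrow> pos \<Rightarrow> bool" where
  "removable lam p \<longleftrightarrow> p \<in> lam \<and> is_partition (lam - {p})"

definition addable :: "pos set \<Rightarrow> pos \<Rightarrow> bool" where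
  "addable lam p \<longleftrightarrow> p \<notin> lam \<and> is_partition (insert p lam)"


section \<open>Words of signs and their reduction\<close>

text \<open>Every sign of a word carries the position it comes from.\<close>

datatype sign = Plus | Minus

type_synonym letter = "sign \<times> pos"

definition letters :: "nat \<Rightarrow> nat \<Rightarrow> pos set \<Rightarrow> letter set" where
  "letters l i lam =
     {(Plus, p) |p. addable lam p \<and> residue l p = i} \<union>
     {(Minus, p) |p. removable lam p \<and> residue l p = i}"

inductive cancel :: "letter list \<Rightarrow> letter list \<Rightarrow> bool" where
  "cancel (u @ (Minus, p) # (Plus, q) # v) (u @ v)"

text \<open>The result of deleting pairs \<open>- +\<close> until there is none left; it does not depend on
  the choices made, see \<open>reduced_unique\<close> below.\<close>

definition reduced :: "letter list \<Rightarrow> letter list" where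
  "reduced w = (THE v. cancel\<^sup>*\<^sup>* w v \<and> (\<nexists>u. cancel v u))"

definition add_rightmost :: "letter list \<Rightarrow> pos set \<Rightarrow> pos set option" where
  "add_rightmost w lam =
     (let ps = filter (\<lambda>x. fst x = Plus) (reduced w)
      in if ps = [] then None else Some (insert (snd (last ps)) lam))"


section \<open>The operators of the two crystals\<close>

text \<open>
  The key functions below are injective on the letters of a fixed residue of a partition
  (\<open>inj_row_key\<close> and \<open>inj_ladder_key\<close>), so that the words contain each letter exactly once,
  by increasing key.
\<close>

definition row_key :: "letter \<Rightarrow> int" where
  "row_key = (\<lambda>(s, (a, b)). - int a)"

definition signature :: "nat \<Rightarrow> nat \<Rightarrow> pos set \<Rightarrow> letter list" where
  "signature l i lam = sorted_key_list_of_set row_key (letters l i lam)"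

definition ladder :: "nat \<Rightarrow> pos \<Rightarrow> pos set" where
  "ladder l = (\<lambda>(a, b).
     {(c, d) \<in> positions. int c - int a = (int l - 1) * (int b - int d)})"

text \<open>Two positions are on the same ladder iff they have the same index (\<open>ladder_iff_index\<close>).\<close>

definition ladder_index :: "nat \<Rightarrow> pos \<Rightarrow> nat" where
  "ladder_index l = (\<lambda>(a, b). a + (l - 1) * (b - 1))"

text \<open>Pairs are compared lexicographically.\<close>

definition ladder_key :: "nat \<Rightarrow> letter \<Rightarrow> nat \<times> nat" where
  "ladder_key l = (\<lambda>(s, p). (ladder_index l p, fst p))"

definition ladder_signature :: "nat \<Rightarrow> nat \<Rightarrow> pos set \<Rightarrow> letter list" where
  "ladder_signature l i lam = sorted_key_list_of_set (ladder_key l) (letters l i lam)"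

text \<open>\<open>None\<close> plays the role of the value \<open>0\<close>.\<close>

definition f_tilde :: "nat \<Rightarrow> nat \<Rightarrow> pos set \<Rightarrow> pos set option" where
  "f_tilde l i lam = add_rightmost (signature l i lam) lam"

definition f_hat :: "nat \<Rightarrow> nat \<Rightarrow> pos set \<Rightarrow> pos set option" where
  "f_hat l i lam = add_rightmost (ladder_signature l i lam) lam"


section \<open>Crystals and their isomorphisms\<close>

text \<open>
  \<open>\<Lambda>\<^sub>0, \<alpha>\<^sub>0, \<dots>, \<alpha>\<^sub>l\<^sub>-\<^sub>1\<close> are linearly independent weights, so an integer combination
  of them is given by its coefficients.
\<close>

datatype weight_basis = Lambda0 | Alpha nat

type_synonym weight = "weight_basis \<Rightarrow> int"

definition partition_weight :: "nat \<Rightarrow> pos set \<Rightarrow> weight" where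
  "partition_weight l lam = (\<lambda>x. case x of
       Lambda0 \<Rightarrow> 1
     | Alpha i \<Rightarrow> if i < l then - int (card {p \<in> lam. residue l p = i}) else 0)"

record 'a crystal =
  nodes :: "'a set"
  arrow :: "nat \<Rightarrow> 'a \<Rightarrow> 'a \<Rightarrow> bool"
  wt :: "'a \<Rightarrow> weight"

definition crystal_iso :: "nat \<Rightarrow> 'a crystal \<Rightarrow> 'b crystal \<Rightarrow> ('a \<Rightarrow> 'b) \<Rightarrow> bool" where
  "crystal_iso l B C \<phi> \<longleftrightarrow>
     bij_betw \<phi> (nodes B) (nodes C) \<and>
     (\<forall>i<l. \<forall>x\<in>nodes B. \<forall>y\<in>nodes B. arrow B i x y \<longleftrightarrow> arrow C i (\<phi> x) (\<phi> y)) \<and>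
     (\<forall>x\<in>nodes B. wt C (\<phi> x) = wt B x)"

definition crystals_isomorphic :: "nat \<Rightarrow> 'a crystal \<Rightarrow> 'b crystal \<Rightarrow> bool" where
  "crystals_isomorphic l B C \<longleftrightarrow> (\<exists>\<phi>. crystal_iso l B C \<phi>)"

definition classical_crystal :: "nat \<Rightarrow> pos set crystal" where
  "classical_crystal l =
     \<lparr> nodes = {lam. is_partition lam \<and> regular l lam},
       arrow = (\<lambda>i lam mu. f_tilde l i lam = Some mu),
       wt = partition_weight l \<rparr>"

inductive_set ladder_nodes :: "nat \<Rightarrow> pos set set" for l :: nat where
  empty: "{} \<in> ladder_nodes l"
| step: "\<lbrakk>lam \<in> ladder_nodes l; i < l; f_hat l i lam = Some mu\<rbrakk> \<Longrightarrow> mu \<in> ladder_nodes l"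

definition ladder_crystal :: "nat \<Rightarrow> pos set crystal" where
  "ladder_crystal l =
     \<lparr> nodes = ladder_nodes l,
       arrow = (\<lambda>i lam mu. f_hat l i lam = Some mu),
       wt = partition_weight l \<rparr>"


section \<open>Well-definedness of the reduction and of the signatures\<close>

fun push :: "letter \<Rightarrow> letter list \<Rightarrow> letter list" where
  "push (Minus, p) ((Plus, q) # w) = w"
| "push x w = x # w"

definition reduce :: "letter list \<Rightarrow> letter list" where
  "reduce w = foldr push w []"

lemma reduce_Nil [simp]: "reduce [] = []"
  and reduce_Cons [simp]: "reduce (x # w) = push x (reduce w)"
  by (simp_all add: reduce_def)

lemma reduce_append: "reduce (u @ v) = foldr push u (reduce v)"
  by (simp add: reduce_def)

lemma cancel_reduce: "cancel w v \<Longrightarrow> reduce w = reduce v"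
  by (induction rule: cancel.induct) (simp add: reduce_append)

lemma cancels_reduce: "cancel\<^sup>*\<^sup>* w v \<Longrightarrow> reduce w = reduce v"
  by (induction rule: rtranclp_induct) (auto dest: cancel_reduce)

lemma cancel_Cons: "cancel w v \<Longrightarrow> cancel (x # w) (x # v)"
  by (erule cancel.cases) (metis append_Cons cancel.intros)

lemma cancels_Cons: "cancel\<^sup>*\<^sup>* w v \<Longrightarrow> cancel\<^sup>*\<^sup>* (x # w) (x # v)"
  by (induction rule: rtranclp_induct) (auto intro: rtranclp.rtrancl_into_rtrancl cancel_Cons)

lemma cancels_push: "cancel\<^sup>*\<^sup>* (x # w) (push x w)"
proof (cases "(x, w)" rule: push.cases)
  case (1 p q w')
  then show ?thesis using cancel.intros[of "[]" p q w'] by auto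
qed auto

lemma cancels_to_reduce: "cancel\<^sup>*\<^sup>* w (reduce w)"
proof (induction w)
  case (Cons x w)
  then show ?case
    using cancels_Cons[OF Cons, of x] cancels_push[of x "reduce w"] by simp
qed simp

lemma reduce_normal: "(\<nexists>u. cancel w u) \<Longrightarrow> reduce w = w"
proof (induction w)
  case (Cons x w)
  then have IH: "reduce w = w" using cancel_Cons by blast
  show ?case
  proof (cases "(x, w)" rule: push.cases)
    case (1 p q w')
    then show ?thesis using Cons.prems cancel.intros[of "[]" p q w'] by auto
  qed (use IH in auto)
qed simp

lemma cancel_length: "cancel w v \<Longrightarrow> length v < length w"
  by (induction rule: cancel.induct) simp

lemma normal_reduce: "\<nexists>u. cancel (reduce w) u"
proof (rule ccontr)
  assume "\<not> ?thesis"
  then obtain u where u: "cancel (reduce w) u" by blast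
  have "length (reduce v) \<le> length v" for v
  proof (induction v)
    case (Cons x v)
    have "length (push x y) \<le> Suc (length y)" for y
      by (cases "(x, y)" rule: push.cases) auto
    from this[of "reduce v"] Cons show ?case by simp
  qed simp
  from this[of u] have "length (reduce u) < length (reduce w)"
    using cancel_length[OF u] by simp
  moreover have "reduce u = reduce w"
    using cancel_reduce[OF u] cancels_reduce[OF cancels_to_reduce, of w] by simp
  ultimately show False by simp
qed

lemma reduced_unique: "\<exists>!v. cancel\<^sup>*\<^sup>* w v \<and> (\<nexists>u. cancel v u)"
proof (rule ex1I[of _ "reduce w"])
  show "cancel\<^sup>*\<^sup>* w (reduce w) \<and> (\<nexists>u. cancel (reduce w) u)"
    using cancels_to_reduce normal_reduce by blast
  show "v = reduce w" if "cancel\<^sup>*\<^sup>* w v \<and> (\<nexists>u. cancel v u)" for v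
    using cancels_reduce[of w v] reduce_normal[of v] that by simp
qed

lemma reduced_eq_reduce: "reduced w = reduce w"
  unfolding reduced_def
  using cancels_to_reduce normal_reduce reduced_unique by (intro the1_equality) auto

lemma partition_row:
  "is_partition lam \<Longrightarrow> (a, b) \<in> lam \<Longrightarrow> 1 \<le> d \<Longrightarrow> d \<le> b \<Longrightarrow> (a, d) \<in> lam"
  unfolding is_partition_def positions_def by force

lemma finite_letters:
  assumes "is_partition lam"
  shows "finite (letters l i lam)"
proof -
  have fin: "finite lam" using assms by (simp add: is_partition_def)
  let ?A = "insert (1, 1) ((\<lambda>(a, b). (Suc a, b)) ` lam \<union> (\<lambda>(a, b). (a, Suc b)) ` lam)"
  have "p \<in> ?A" if "addable lam p" for p
  proof -
    obtain a b where p: "p = (a, b)" by force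
    have *: "(c, d) \<in> lam" if "1 \<le> c" "1 \<le> d" "c \<le> a" "d \<le> b" "(c, d) \<noteq> (a, b)" for c d
    proof -
      have "(c, d) \<in> insert p lam"
        using \<open>addable lam p\<close> that p unfolding addable_def is_partition_def positions_def
        by (meson SigmaI atLeast_iff insertI1)
      then show ?thesis using that p by blast
    qed
    have ab: "1 \<le> a" "1 \<le> b"
      using that p by (auto simp: addable_def is_partition_def positions_def)
    consider "a = 1" "b = 1" | "a > 1" | "b > 1" using ab by linarith
    then show ?thesis
    proof cases
      case 2
      then have "(a - 1, b) \<in> lam" using * ab by simp
      then show ?thesis using 2 p by (auto intro!: rev_image_eqI[of "(a - 1, b)"])
    next
      case 3
      then have "(a, b - 1) \<in> lam" using * ab by simp
      then show ?thesis using 3 p by (auto intro!: rev_image_eqI[of "(a, b - 1)"])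
    qed (use p in simp)
  qed
  then have "letters l i lam \<subseteq> Pair Plus ` ?A \<union> Pair Minus ` lam"
    unfolding letters_def removable_def by blast
  then show ?thesis using fin by (meson finite.insertI finite_UnI finite_imageI finite_subset)
qed

lemma inj_row_key:
  assumes "is_partition lam" "2 \<le> l"
  shows "inj_on row_key (letters l i lam)"
proof -
  have pos: "1 \<le> a \<and> 1 \<le> b" if "(a, b) \<in> lam \<or> addable lam (a, b)" for a b
    using that assms(1) unfolding is_partition_def addable_def positions_def by auto
  have PP: "b = b'" if "addable lam (a, b)" "addable lam (a, b')" for a b b'
  proof -
    have False if "addable lam (a, b)" "addable lam (a, b')" "b < b'" for b b'
      using partition_row[of "insert (a, b') lam" a b' b] that pos[of a b]
      by (auto simp: addable_def)
    then show ?thesis using that by (metis linorder_neqE_nat)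
  qed
  have MM: "b = b'" if "removable lam (a, b)" "removable lam (a, b')" for a b b'
  proof -
    have False if "removable lam (a, b)" "removable lam (a, b')" "b < b'" for b b'
      using partition_row[of "lam - {(a, b)}" a b' b] that pos[of a b]
      by (auto simp: removable_def)
    then show ?thesis using that by (metis linorder_neqE_nat)
  qed
  have PM: False
    if "addable lam (a, b)" "removable lam (a, b')" "residue l (a, b) = residue l (a, b')" for a b b'
  proof -
    have 1: "1 \<le> b'" "1 \<le> b"
      using that pos by (auto simp: removable_def)
    have "b' < b"
      using partition_row[OF assms(1), of a b' b] that 1 by (force simp: addable_def removable_def)
    moreover have "\<not> Suc b' < b"
    proof
      assume "Suc b' < b"
      then have "(a, Suc b') \<in> lam"
        using partition_row[of "insert (a, b) lam" a b "Suc b'"] that by (auto simp: addable_def)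
      then show False
        using partition_row[of "lam - {(a, b')}" a "Suc b'" b'] that 1 by (auto simp: removable_def)
    qed
    ultimately have b: "b = Suc b'" by simp
    have "int (residue l (a, c)) = (int c - int a) mod int l" for c
      using assms(2) by (simp add: residue_def)
    then have "(int b - int a) mod int l = (int b' - int a) mod int l"
      using that(3) by metis
    then have "int l dvd (int b - int a) - (int b' - int a)" by (simp add: mod_eq_dvd_iff)
    then show False using b assms(2) by (simp add: zdvd_not_zless)
  qed
  show ?thesis
  proof (rule inj_onI)
    fix x y
    assume xy: "x \<in> letters l i lam" "y \<in> letters l i lam" "row_key x = row_key y"
    obtain s a b where x: "x = (s, (a, b))" by (metis prod.exhaust)
    obtain t b' where y: "y = (t, (a, b'))"
      using xy(3) x by (cases y) (auto simp: row_key_def)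
    have res: "residue l (a, b) = residue l (a, b')" using xy x y by (auto simp: letters_def)
    have add: "addable lam p" if "(Plus, p) \<in> letters l i lam" for p
      using that unfolding letters_def by blast
    have rem: "removable lam p" if "(Minus, p) \<in> letters l i lam" for p
      using that unfolding letters_def by blast
    show "x = y"
    proof (cases s; cases t)
      assume "s = Plus" "t = Plus"
      then show ?thesis using PP[of a b b'] add xy(1,2) x y by simp
    next
      assume "s = Minus" "t = Minus"
      then show ?thesis using MM[of a b b'] rem xy(1,2) x y by simp
    next
      assume "s = Plus" "t = Minus"
      then show ?thesis using PM[of a b b'] add rem res xy(1,2) x y by simp
    next
      assume "s = Minus" "t = Plus"
      then show ?thesis using PM[of a b' b] add rem res xy(1,2) x y by simp
    qed
  qed
qed

lemma inj_ladder_key: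
  assumes "is_partition lam" "2 \<le> l"
  shows "inj_on (ladder_key l) (letters l i lam)"
proof (rule inj_onI)
  fix x y assume xy: "x \<in> letters l i lam" "y \<in> letters l i lam" "ladder_key l x = ladder_key l y"
  then have "row_key x = row_key y" by (auto simp: ladder_key_def row_key_def split: prod.splits)
  then show "x = y" using inj_row_key[OF assms] xy(1,2) by (meson inj_onD)
qed

lemma (in linorder) sorted_key_list_of_set_props:
  assumes "inj_on f A" "finite A"
  shows "set (sorted_key_list_of_set f A) = A \<and> distinct (sorted_key_list_of_set f A) \<and>
    sorted (map f (sorted_key_list_of_set f A))"
proof -
  interpret folding_insort_key "(\<le>)" "(<)" A f
    by unfold_locales (rule assms(1))
  show ?thesis
    using assms(2) distinct_sorted_key_list_of_set[of A] by (simp add: distinct_map)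
qed

lemma signature_enumerates:
  assumes "is_partition lam" "2 \<le> l"
  shows "set (signature l i lam) = letters l i lam \<and> distinct (signature l i lam) \<and>
    sorted (map row_key (signature l i lam))"
  unfolding signature_def
  by (rule sorted_key_list_of_set_props[OF inj_row_key[OF assms] finite_letters[OF assms(1)]])

lemma ladder_signature_enumerates:
  assumes "is_partition lam" "2 \<le> l"
  shows "set (ladder_signature l i lam) = letters l i lam \<and> distinct (ladder_signature l i lam) \<and>
    sorted (map (ladder_key l) (ladder_signature l i lam))"
  unfolding ladder_signature_def
  by (rule sorted_key_list_of_set_props[OF inj_ladder_key[OF assms] finite_letters[OF assms(1)]])

lemma ladder_iff_index:
  assumes "1 \<le> l" "p \<in> positions"
  shows "q \<in> ladder l p \<longleftrightarrow> q \<in> positions \<and> ladder_index l q = ladder_index l p"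
proof -
  obtain a b c d where pq: "p = (a, b)" "q = (c, d)" by force
  have "int c - int a = (int l - 1) * (int b - int d) \<longleftrightarrow>
      int (ladder_index l q) = int (ladder_index l p)" if "q \<in> positions"
  proof -
    have ge: "1 \<le> b" "1 \<le> d" using that assms(2) by (auto simp: pq positions_def)
    have "int (ladder_index l p) = int a + (int l - 1) * (int b - 1)"
      "int (ladder_index l q) = int c + (int l - 1) * (int d - 1)"
      unfolding pq ladder_index_def prod.case of_nat_add of_nat_mult
      using ge assms(1) by (simp_all only: of_nat_diff of_nat_1)
    then show ?thesis by (auto simp: algebra_simps)
  qed
  then show ?thesis by (auto simp: ladder_def pq)
qed

end

theory Submission
  imports Defs
begin

text \<open>
  The isomorphism matches a regular partition with the node of the ladder crystal that has the same
  number of boxes on each ladder. Regular partitions are the ones whose ladders are filled from the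
  top, and nodes of the ladder crystal are \<open>locked\<close>: no row can be slid down along its ladders. Both
  properties make the partition unique for the given numbers, and in both signatures the pluses on
  one ladder precede the minuses.

  The \<open>i\<close>-ladders are those of index \<open>m, m + l, m + 2 l, \<dots>\<close>. Counting shows that the number of
  pluses on ladder \<open>m\<close> minus the number of minuses on ladder \<open>m - l\<close> depends only on the
  numbers of boxes on the ladders. Hence so does the height, the excess of pluses over minuses at
  the end of the block of pluses of a ladder. The signature rule adds a box on the first ladder
  where the height is maximal, if this maximum is positive, so both operators choose the same
  ladder.
\<close>

section \<open>The letter chosen by the signature rule\<close>

text \<open>The nodes of the ladder crystal are known only through reachability, and no formula is
  at hand for the partner of a regular partition. The isomorphism is therefore handled as a
  relation, \<open>ladder_related\<close>, and the work lies in showing that both operators preserve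
  it. The delicate invariant is \<open>locked\<close>. Adding a box can violate it in two ways. One
  is excluded because the box is the lowest addable one of its ladder. The other needs the
  maximality of the height: the next ladder of the same residue cannot have a plus while the chosen
  ladder has no minus, as the height would still grow. The hypothesis \<open>3 \<le> l\<close>
  enters there too, since it keeps boxes on consecutive ladders out of a common row. Conversely,
  every regular partition needs a predecessor under \<open>f_tilde\<close>, so that a path from the
  empty diagram can be transported to the ladder side. It is found from the heights as well, at
  their last maximum instead of the first.\<close>

fun balance :: "letter list \<Rightarrow> int" where
  "balance [] = 0"
| "balance ((Plus, p) # w) = 1 + balance w"
| "balance ((Minus, p) # w) = balance w - 1"

lemma balance_append [simp]: "balance (u @ v) = balance u + balance v"
  by (induction u rule: balance.induct) auto

lemma balance_eq_card:
  assumes "distinct w"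
  shows "balance w = int (card {p. (Plus, p) \<in> set w}) - int (card {p. (Minus, p) \<in> set w})"
proof -
  have fin: "finite {p. (s, p) \<in> set w}" for s :: sign and w :: "letter list"
    by (rule finite_subset[of _ "snd ` set w"]) force+
  show ?thesis
    using assms
  proof (induction w rule: balance.induct)
    case (2 p w)
    have "{q. (Plus, q) \<in> set ((Plus, p) # w)} = insert p {q. (Plus, q) \<in> set w}"
      "{q. (Minus, q) \<in> set ((Plus, p) # w)} = {q. (Minus, q) \<in> set w}"
      by auto
    then show ?case using 2 fin[where w = w] by (simp only: card_insert_if) simp
  next
    case (3 p w)
    have "{q. (Minus, q) \<in> set ((Minus, p) # w)} = insert p {q. (Minus, q) \<in> set w}"
      "{q. (Plus, q) \<in> set ((Minus, p) # w)} = {q. (Plus, q) \<in> set w}"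
      by auto
    then show ?case using 3 fin[where w = w] by (simp only: card_insert_if) simp
  qed simp
qed

definition surviving :: "letter list \<Rightarrow> letter list" where
  "surviving w = filter (\<lambda>x. fst x = Plus) (reduce w)"

text \<open>A minus put in front of a reduced word either cancels against the leading plus or finds
  no plus at all, so no minus is ever left before a plus.\<close>

lemma reduce_shape: "\<exists>ps ms. reduce w = map (Pair Plus) ps @ map (Pair Minus) ms"
proof (induction w)
  case (Cons x w)
  then obtain ps ms where IH: "reduce w = map (Pair Plus) ps @ map (Pair Minus) ms" by blast
  obtain s p where x: "x = (s, p)" by (cases x)
  show ?case
  proof (cases s)
    case Plus
    then have "reduce (x # w) = map (Pair Plus) (p # ps) @ map (Pair Minus) ms"
      using IH x by simp
    then show ?thesis by blast
  next
    case Minus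
    show ?thesis
    proof (cases ps)
      case Nil
      then have "reduce (x # w) = map (Pair Plus) [] @ map (Pair Minus) (p # ms)"
        using IH x Minus by (cases ms) simp_all
      then show ?thesis by blast
    next
      case (Cons q qs)
      then have "reduce (x # w) = map (Pair Plus) qs @ map (Pair Minus) ms"
        using IH x Minus by simp
      then show ?thesis by blast
    qed
  qed
qed simp

text \<open>Because the pluses come first in a reduced word, a new minus deletes the first of them;
  \<open>tl [] = []\<close> covers the case where none is left. With this recursion the reduction
  itself can be forgotten.\<close>

lemma surviving_simps [simp]:
  "surviving [] = []"
  "surviving ((Plus, p) # w) = (Plus, p) # surviving w"
  "surviving ((Minus, p) # w) = tl (surviving w)"
proof -
  obtain ps ms where w: "reduce w = map (Pair Plus) ps @ map (Pair Minus) ms"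
    using reduce_shape by blast
  show "surviving ((Minus, p) # w) = tl (surviving w)"
  proof (cases ps)
    case Nil
    then show ?thesis using w by (cases ms) (auto simp: surviving_def filter_map o_def)
  next
    case (Cons q qs)
    then show ?thesis using w by (simp add: surviving_def)
  qed
qed (simp_all add: surviving_def)

text \<open>The number of surviving pluses is the maximal balance of a prefix, the empty one
  included. This is the upper bound; \<open>last_surviving\<close> shows where it is
  attained.\<close>

lemma balance_le_surviving: "w = u @ v \<Longrightarrow> balance u \<le> int (length (surviving w))"
proof (induction w arbitrary: u rule: balance.induct)
  case (2 p w)
  then show ?case by (cases u) auto
next
  case (3 p w)
  then show ?case by (cases u) (auto simp: of_nat_diff_if)
qed simp

text \<open>The last surviving plus is where the balance of the prefixes first reaches its maximum.\<close>

lemma last_surviving: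
  assumes "surviving w \<noteq> []"
  shows "\<exists>u p v. w = u @ (Plus, p) # v \<and> last (surviving w) = (Plus, p) \<and>
    int (length (surviving w)) = balance u + 1 \<and>
    (\<forall>u1 u2. u = u1 @ u2 \<longrightarrow> balance u1 \<le> balance u) \<and>
    (\<forall>v1 v2. v = v1 @ v2 \<longrightarrow> balance v1 \<le> 0)"
  using assms
proof (induction w rule: balance.induct)
  case (2 p w)
  show ?case
  proof (cases "surviving w = []")
    case True
    then have "balance v1 \<le> 0" if "w = v1 @ v2" for v1 v2
      using balance_le_surviving[OF that] by simp
    then show ?thesis using True
      by (intro exI[of _ "[]"] exI[of _ p] exI[of _ w]) auto
  next
    case False
    then obtain u q v where IH: "w = u @ (Plus, q) # v" "last (surviving w) = (Plus, q)"
      "int (length (surviving w)) = balance u + 1"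
      "\<And>u1 u2. u = u1 @ u2 \<Longrightarrow> balance u1 \<le> balance u"
      "\<forall>v1 v2. v = v1 @ v2 \<longrightarrow> balance v1 \<le> 0"
      using 2 by blast
    have "balance u1 \<le> balance ((Plus, p) # u)" if "(Plus, p) # u = u1 @ u2" for u1 u2
      using that IH(4) IH(4)[of "[]"] by (cases u1) auto
    then show ?thesis using IH False
      by (intro exI[of _ "(Plus, p) # u"] exI[of _ q] exI[of _ v]) auto
  qed
next
  case (3 p w)
  then have ne: "surviving w \<noteq> []" by auto
  then obtain u q v where IH: "w = u @ (Plus, q) # v" "last (surviving w) = (Plus, q)"
    "int (length (surviving w)) = balance u + 1"
    "\<And>u1 u2. u = u1 @ u2 \<Longrightarrow> balance u1 \<le> balance u"
    "\<forall>v1 v2. v = v1 @ v2 \<longrightarrow> balance v1 \<le> 0"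
    using 3 by blast
  \<comment> \<open>The new minus removes one surviving plus and one remains, so \<open>w\<close>
    has at least two. Hence the balance of \<open>u\<close> stays nonnegative after the minus is
    prepended, as the empty prefix requires.\<close>
  obtain x y r where s: "surviving w = x # y # r"
    using 3(2) by (cases "surviving w"; cases "tl (surviving w)") auto
  then have "balance u \<ge> 1" using IH(3) by simp
  have "balance u1 \<le> balance ((Minus, p) # u)" if "(Minus, p) # u = u1 @ u2" for u1 u2
  proof (cases u1)
    case Nil
    then show ?thesis using \<open>balance u \<ge> 1\<close> by simp
  next
    case (Cons x u1')
    then have "u = u1' @ u2" "x = (Minus, p)" using that by simp_all
    then show ?thesis using IH(4)[of u1' u2] Cons by simp
  qed
  then show ?case using IH s
    by (intro exI[of _ "(Minus, p) # u"] exI[of _ q] exI[of _ v]) auto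
qed simp

lemma add_rightmost_surviving:
  "add_rightmost w lam =
    (if surviving w = [] then None else Some (insert (snd (last (surviving w))) lam))"
  by (simp add: add_rightmost_def reduced_eq_reduce surviving_def Let_def)

lemma sorted_filter_split:
  fixes k :: "'a \<Rightarrow> 'b::linorder"
  assumes "sorted (map k w)"
  shows "w = filter (\<lambda>x. k x \<le> c) w @ filter (\<lambda>x. \<not> k x \<le> c) w"
  using assms
proof (induction w)
  case (Cons x w)
  show ?case
  proof (cases "k x \<le> c")
    case False
    then have "\<not> k y \<le> c" if "y \<in> set w" for y
      using Cons.prems that by (auto dest: order_trans)
    then have "filter (\<lambda>x. k x \<le> c) w = []" "filter (\<lambda>x. \<not> k x \<le> c) w = w"
      by (simp_all add: filter_empty_conv)
    then show ?thesis using False by simp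
  qed (use Cons in auto)
qed simp


section \<open>Heights\<close>

text \<open>Counted by cardinalities and not along a word, because the same quantity has to be
  compared between words in different reading orders.\<close>

definition height :: "nat \<Rightarrow> nat \<Rightarrow> pos set \<Rightarrow> nat \<Rightarrow> int" where
  "height l i lam m =
     int (card {p. addable lam p \<and> residue l p = i \<and> ladder_index l p \<le> m}) -
     int (card {p. removable lam p \<and> residue l p = i \<and> ladder_index l p < m})"

text \<open>Coarser than both reading orders: it only asks for ladders from left to right and, on
  each ladder, pluses before minuses. The value \<open>(m, 0)\<close> cuts a word just after the
  pluses of ladder \<open>m\<close>, which is where \<open>height\<close> is measured.\<close>

definition sign_key :: "nat \<Rightarrow> letter \<Rightarrow> nat \<times> nat" where
  "sign_key l = (\<lambda>(s, p). (ladder_index l p, if s = Plus then 0 else 1))"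

lemma height_eq_balance:
  assumes "set w = letters l i lam" "distinct w"
  shows "height l i lam m = balance (filter (\<lambda>x. sign_key l x \<le> (m, 0)) w)"
proof -
  have "distinct (filter (\<lambda>x. sign_key l x \<le> (m, 0)) w)" using assms by simp
  moreover have "{p. (Plus, p) \<in> set (filter (\<lambda>x. sign_key l x \<le> (m, 0)) w)} =
      {p. addable lam p \<and> residue l p = i \<and> ladder_index l p \<le> m}"
    using assms by (auto simp: letters_def sign_key_def)
  moreover have "{p. (Minus, p) \<in> set (filter (\<lambda>x. sign_key l x \<le> (m, 0)) w)} =
      {p. removable lam p \<and> residue l p = i \<and> ladder_index l p < m}"
    using assms by (auto simp: letters_def sign_key_def)
  ultimately show ?thesis unfolding height_def by (simp only: balance_eq_card)
qed

lemma add_rightmost_NoneD: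
  assumes "set w = letters l i lam" "distinct w" "sorted (map (sign_key l) w)"
    "add_rightmost w lam = None"
  shows "height l i lam m \<le> 0"
  using balance_le_surviving[OF sorted_filter_split[OF assms(3)]] assms
  by (auto simp: height_eq_balance[OF assms(1,2)] add_rightmost_surviving split: if_splits)

text \<open>The balance peaks right after the letter of \<open>p\<close>. Since this letter closes
  the block of pluses of its ladder, the peak is one of the heights.\<close>

lemma add_rightmost_SomeD:
  assumes w: "set w = letters l i lam" "distinct w" and sorted: "sorted (map (sign_key l) w)"
    and "add_rightmost w lam = Some mu"
  obtains u p v where "w = u @ (Plus, p) # v" "mu = insert p lam" "addable lam p" "residue l p = i"
    "0 < height l i lam (ladder_index l p)"
    "\<And>m. height l i lam m \<le> height l i lam (ladder_index l p)"
    "\<And>m. m < ladder_index l p \<Longrightarrow> height l i lam m < height l i lam (ladder_index l p)"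
    "\<And>q. (Plus, q) \<in> set v \<Longrightarrow> ladder_index l q \<noteq> ladder_index l p"
proof -
  have ne: "surviving w \<noteq> []" and mu: "mu = insert (snd (last (surviving w))) lam"
    using assms(4) by (auto simp: add_rightmost_surviving split: if_splits)
  obtain u p v where d: "w = u @ (Plus, p) # v" "last (surviving w) = (Plus, p)"
      "int (length (surviving w)) = balance u + 1"
    and u: "\<And>u1 u2. u = u1 @ u2 \<Longrightarrow> balance u1 \<le> balance u"
    and v: "\<And>v1 v2. v = v1 @ v2 \<Longrightarrow> balance v1 \<le> 0"
    using last_surviving[OF ne] by blast
  let ?F = "\<lambda>m. filter (\<lambda>x. sign_key l x \<le> (m, 0))"
  let ?m = "ladder_index l p"
  have le: "height l i lam m \<le> balance u + 1" for m
    using balance_le_surviving[OF sorted_filter_split[OF sorted]] d(3)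
    by (simp add: height_eq_balance[OF w])
  have su: "sorted (map (sign_key l) u)" and sv: "sorted (map (sign_key l) v)"
    using sorted d(1) by (simp_all add: sorted_append)
  \<comment> \<open>If another plus of this ladder followed, sortedness would make the very next
    letter a plus, and the prefix of length one of \<open>v\<close> would have balance 1.\<close>
  have last: "ladder_index l q \<noteq> ?m" if "(Plus, q) \<in> set v" for q
  proof
    assume q: "ladder_index l q = ?m"
    obtain x v' where v': "v = x # v'" using \<open>(Plus, q) \<in> set v\<close> by (cases v) auto
    have "sign_key l (Plus, p) \<le> sign_key l x" "sign_key l x \<le> sign_key l (Plus, q)"
      using sorted d(1) v' that by (auto simp: sorted_append)
    then have "fst x = Plus"
      using q by (cases x) (auto simp: sign_key_def split: if_splits)
    then obtain y where "x = (Plus, y)" by (cases x) auto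
    then show False using v[of "[x]" v'] v' by simp
  qed
  have "sign_key l x \<le> (?m, 0)" if "x \<in> set u" for x
    using that sorted d(1) by (auto simp: sorted_append sign_key_def)
  then have "?F ?m u = u" by simp
  moreover have "?F ?m v = []"
  proof -
    have "\<not> sign_key l x \<le> (?m, 0)" if "x \<in> set v" for x
    proof
      assume "sign_key l x \<le> (?m, 0)"
      moreover have "sign_key l (Plus, p) \<le> sign_key l x"
        using sorted d(1) that by (auto simp: sorted_append)
      ultimately have "fst x = Plus \<and> ladder_index l (snd x) = ?m"
        by (cases x) (auto simp: sign_key_def split: if_splits)
      then show False using last[of "snd x"] that by (cases x) auto
    qed
    then show ?thesis by (simp add: filter_empty_conv)
  qed
  ultimately have hm: "height l i lam ?m = balance u + 1"
    unfolding height_eq_balance[OF w] d(1) by (simp add: sign_key_def)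
  \<comment> \<open>The cut for an earlier ladder falls inside \<open>u\<close>, whose prefixes have
    balance at most \<open>balance u\<close>, one less than the peak.\<close>
  have lt: "height l i lam m < height l i lam ?m" if "m < ?m" for m
  proof -
    have "\<not> sign_key l x \<le> (m, 0)" if "x \<in> set v" for x
    proof -
      have "sign_key l (Plus, p) \<le> sign_key l x"
        using sorted d(1) that by (auto simp: sorted_append)
      then show ?thesis using \<open>m < ?m\<close> by (cases x) (auto simp: sign_key_def split: if_splits)
    qed
    then have "?F m v = []" by (simp add: filter_empty_conv)
    then have "?F m w = ?F m u" using that d(1) by (simp add: sign_key_def)
    then show ?thesis
      using u[OF sorted_filter_split[OF su]] hm by (simp add: height_eq_balance[OF w])
  qed
  have "0 \<le> balance u" using u[of "[]"] by simp
  moreover have "(Plus, p) \<in> letters l i lam" using w d(1) by auto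
  then have "addable lam p" "residue l p = i" by (auto simp: letters_def)
  ultimately show thesis
    using that[of u p v] d mu hm le lt last by (auto simp: hm)
qed


section \<open>Diagrams and ladders\<close>

lemma partition_finite: "is_partition lam \<Longrightarrow> finite lam"
  and partition_subset: "is_partition lam \<Longrightarrow> lam \<subseteq> positions"
  and partition_closed: "is_partition lam \<Longrightarrow> (a, b) \<in> lam \<Longrightarrow> (c, d) \<in> positions \<Longrightarrow> c \<le> a \<Longrightarrow> d \<le> b
    \<Longrightarrow> (c, d) \<in> lam"
  unfolding is_partition_def by blast+

lemma partition_posD: "is_partition lam \<Longrightarrow> (a, b) \<in> lam \<Longrightarrow> 1 \<le> a \<and> 1 \<le> b"
  by (drule partition_subset) (auto simp: positions_def)

lemma partition_mono:
  assumes "is_partition lam" "(a, b) \<in> lam" "1 \<le> c" "c \<le> a" "1 \<le> d" "d \<le> b"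
  shows "(c, d) \<in> lam"
  by (rule partition_closed[OF assms(1,2)]) (use assms in \<open>simp_all add: positions_def\<close>)

lemma is_partitionI:
  assumes "finite lam" "lam \<subseteq> positions"
    and "\<And>a b c d. (a, b) \<in> lam \<Longrightarrow> (c, d) \<in> positions \<Longrightarrow> c \<le> a \<Longrightarrow> d \<le> b \<Longrightarrow> (c, d) \<in> lam"
  shows "is_partition lam"
  unfolding is_partition_def
  by (intro conjI allI impI assms(1,2)) (erule assms(3), assumption+)

lemma addable_iff:
  assumes "is_partition lam"
  shows "addable lam (a, b) \<longleftrightarrow> (a, b) \<notin> lam \<and> 1 \<le> a \<and> 1 \<le> b \<and>
    (a = 1 \<or> (a - 1, b) \<in> lam) \<and> (b = 1 \<or> (a, b - 1) \<in> lam)" (is "_ \<longleftrightarrow> ?R")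
proof
  assume A: "addable lam (a, b)"
  then have P: "is_partition (insert (a, b) lam)" and n: "(a, b) \<notin> lam"
    by (auto simp: addable_def)
  have ab: "1 \<le> a" "1 \<le> b" using partition_posD[OF P, of a b] by auto
  have "(a - 1, b) \<in> lam" if "a \<noteq> 1"
  proof -
    have "1 \<le> a - 1" "a - 1 \<noteq> a" using that ab by linarith+
    then show ?thesis using partition_mono[OF P, of a b "a - 1" b] ab by simp
  qed
  moreover have "(a, b - 1) \<in> lam" if "b \<noteq> 1"
  proof -
    have "1 \<le> b - 1" "b - 1 \<noteq> b" using that ab by linarith+
    then show ?thesis using partition_mono[OF P, of a b a "b - 1"] ab by simp
  qed
  ultimately show ?R using n ab by blast
next
  assume R: ?R
  have closed: "(c, d) \<in> insert (a, b) lam"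
    if "(e, g) \<in> insert (a, b) lam" "(c, d) \<in> positions" "c \<le> e" "d \<le> g" for c d e g
  proof (cases "(e, g) \<in> lam")
    case True
    then show ?thesis using partition_closed[OF assms _ that(2-4)] by blast
  next
    case False
    then have eg: "e = a" "g = b" using that by auto
    have cd: "1 \<le> c" "1 \<le> d" using that by (auto simp: positions_def)
    have "c = a \<and> d = b \<or> c < a \<or> d < b" using that(3,4) eg by linarith
    then show ?thesis
    proof (elim disjE)
      assume "c < a"
      then show ?thesis using R partition_mono[OF assms, of "a - 1" b c d] cd that(4) eg by auto
    next
      assume "d < b"
      then show ?thesis using R partition_mono[OF assms, of a "b - 1" c d] cd that(3) eg by auto
    qed simp
  qed
  have "(a, b) \<in> positions" using R by (simp add: positions_def)
  then have "is_partition (insert (a, b) lam)"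
    using partition_finite[OF assms] partition_subset[OF assms]
    by (intro is_partitionI) (simp, simp, rule closed)
  then show "addable lam (a, b)"
    using R by (simp add: addable_def)
qed

lemma removable_iff:
  assumes "is_partition lam"
  shows "removable lam (a, b) \<longleftrightarrow> (a, b) \<in> lam \<and> (Suc a, b) \<notin> lam \<and> (a, Suc b) \<notin> lam"
    (is "_ \<longleftrightarrow> ?R")
proof
  assume A: "removable lam (a, b)"
  then have P: "is_partition (lam - {(a, b)})" and i: "(a, b) \<in> lam"
    by (auto simp: removable_def)
  then show ?R
    using partition_posD[OF assms i] partition_mono[OF P, of "Suc a" b a b]
      partition_mono[OF P, of a "Suc b" a b] by auto
next
  assume R: ?R
  have ne: "(c, d) \<noteq> (a, b)" if "(e, g) \<in> lam - {(a, b)}" "c \<le> e" "d \<le> g" for c d e g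
  proof
    assume cd: "(c, d) = (a, b)"
    then have "a < e \<or> b < g" using that by (auto simp: nat_less_le)
    then show False
    proof
      assume "a < e"
      then show False
        using R cd that partition_mono[OF assms, of e g "Suc a" b]
          partition_posD[OF assms, of a b] by simp
    next
      assume "b < g"
      then show False
        using R cd that partition_mono[OF assms, of e g a "Suc b"]
          partition_posD[OF assms, of a b] by simp
    qed
  qed
  have closed: "(c, d) \<in> lam - {(a, b)}"
    if "(e, g) \<in> lam - {(a, b)}" "(c, d) \<in> positions" "c \<le> e" "d \<le> g" for c d e g
    using partition_closed[OF assms _ that(2-4)] ne[OF that(1,3,4)] that(1) by simp
  have "is_partition (lam - {(a, b)})"
  proof (rule is_partitionI)
    show "finite (lam - {(a, b)})" using partition_finite[OF assms] by simp
    show "lam - {(a, b)} \<subseteq> positions" using partition_subset[OF assms] by blast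
  qed (rule closed)
  then show "removable lam (a, b)"
    using R by (simp add: removable_def)
qed

lemma addable_partition: "addable lam p \<Longrightarrow> is_partition (insert p lam)"
  by (simp add: addable_def)

lemma addable_positions: "addable lam p \<Longrightarrow> p \<in> positions"
  by (drule addable_partition, drule partition_subset) simp

lemma removable_positions: "is_partition lam \<Longrightarrow> removable lam p \<Longrightarrow> p \<in> positions"
  by (drule partition_subset) (auto simp: removable_def)

lemma finite_addable: "is_partition lam \<Longrightarrow> finite {p. addable lam p \<and> P p}"
  and finite_removable: "is_partition lam \<Longrightarrow> finite {p. removable lam p \<and> P p}"
proof -
  assume lam: "is_partition lam"
  show "finite {p. removable lam p \<and> P p}"
    by (rule finite_subset[OF _ partition_finite[OF lam]]) (auto simp: removable_def)
  \<comment> \<open>Modulo 1 all residues agree, so \<open>finite_letters\<close> bounds the addable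
    positions of every residue at once.\<close>
  have "residue 1 p = 0" for p by (cases p) (simp add: residue_def)
  then have "{p. addable lam p \<and> P p} \<subseteq> snd ` letters 1 0 lam"
    by (auto simp: letters_def intro!: rev_image_eqI)
  then show "finite {p. addable lam p \<and> P p}"
    by (rule finite_subset) (simp add: finite_letters[OF lam])
qed

section \<open>Ladder indices and residues\<close>

lemma ladder_index_Suc_row: "ladder_index l (Suc a, b) = Suc (ladder_index l (a, b))"
  by (simp add: ladder_index_def)

lemma ladder_index_Suc_column:
  "1 \<le> b \<Longrightarrow> ladder_index l (a, Suc b) = ladder_index l (a, b) + (l - 1)"
  by (cases b) (simp_all add: ladder_index_def)

text \<open>A step down changes the index by 1 and the residue by -1; a step to the right changes
  them by \<open>l - 1\<close> and 1. So index plus residue is constant modulo \<open>l\<close>, and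
  it is 1 at \<open>(1, 1)\<close>.\<close>

definition ladder_residue :: "nat \<Rightarrow> nat \<Rightarrow> nat" where
  "ladder_residue l m = nat ((1 - int m) mod int l)"

lemma residue_ladder:
  assumes "1 \<le> l" "p \<in> positions"
  shows "residue l p = ladder_residue l (ladder_index l p)"
proof -
  obtain a b where p: "p = (a, b)" by force
  then have ge: "1 \<le> b" using assms(2) by (auto simp: positions_def)
  have "int (ladder_index l p) = int a + (int l - 1) * (int b - 1)"
    unfolding p ladder_index_def prod.case of_nat_add of_nat_mult
    using ge assms(1) by (simp only: of_nat_diff of_nat_1)
  then have "int b - int a = (1 - int (ladder_index l p)) + int l * (int b - 1)"
    by (simp add: algebra_simps)
  then show ?thesis by (simp add: residue_def ladder_residue_def p)
qed

lemma ladder_residue_eq_iff: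
  assumes "1 \<le> l"
  shows "ladder_residue l m = ladder_residue l n \<longleftrightarrow> m mod l = n mod l"
proof -
  have "ladder_residue l m = ladder_residue l n \<longleftrightarrow> (1 - int m) mod int l = (1 - int n) mod int l"
    using assms unfolding ladder_residue_def by (subst eq_nat_nat_iff) simp_all
  also have "\<dots> \<longleftrightarrow> int m mod int l = int n mod int l"
    by (simp add: mod_eq_dvd_iff dvd_diff_commute)
  also have "\<dots> \<longleftrightarrow> m mod l = n mod l"
    by (simp flip: zmod_int)
  finally show ?thesis .
qed

definition content :: "nat \<Rightarrow> pos set \<Rightarrow> nat \<Rightarrow> nat" where
  "content l lam m = card {z \<in> lam. ladder_index l z = m}"

lemma ladder_index_pos: "p \<in> positions \<Longrightarrow> 1 \<le> ladder_index l p"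
  by (auto simp: positions_def ladder_index_def)

lemma content_insert:
  assumes "finite lam" "p \<notin> lam"
  shows "content l (insert p lam) m = content l lam m + of_bool (ladder_index l p = m)"
proof (cases "ladder_index l p = m")
  case True
  then have "{z \<in> insert p lam. ladder_index l z = m} = insert p {z \<in> lam. ladder_index l z = m}"
    by blast
  then show ?thesis using assms True by (simp add: content_def)
next
  case False
  then have "{z \<in> insert p lam. ladder_index l z = m} = {z \<in> lam. ladder_index l z = m}"
    by blast
  then show ?thesis using False by (simp add: content_def)
qed

section \<open>Counting letters ladder by ladder\<close>

definition ladder_addables :: "nat \<Rightarrow> pos set \<Rightarrow> nat \<Rightarrow> pos set" where
  "ladder_addables l lam m = {p. addable lam p \<and> ladder_index l p = m}"

definition ladder_removables :: "nat \<Rightarrow> pos set \<Rightarrow> nat \<Rightarrow> pos set" where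
  "ladder_removables l lam m = {p. removable lam p \<and> ladder_index l p = m}"

definition ladder_positions :: "nat \<Rightarrow> nat \<Rightarrow> pos set" where
  "ladder_positions l m = {p \<in> positions. ladder_index l p = m}"

lemma finite_ladder_positions:
  assumes "2 \<le> l"
  shows "finite (ladder_positions l m)"
proof (rule finite_subset)
  show "ladder_positions l m \<subseteq> {..m} \<times> {..m + 1}"
  proof
    fix p assume p: "p \<in> ladder_positions l m"
    obtain a b where ab: "p = (a, b)" by force
    have "1 * (b - 1) \<le> (l - 1) * (b - 1)" using assms by (intro mult_right_mono) auto
    then have "b \<le> 1 + (l - 1) * (b - 1)" by linarith
    then show "p \<in> {..m} \<times> {..m + 1}"
      using p ab by (auto simp: ladder_positions_def ladder_index_def)
  qed
qed simp

text \<open>Translation by \<open>(r, c)\<close> is the bijection. The guards keep the truncated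
  subtractions exact. For \<open>m \<le> k\<close> both sides are empty, as no position has index
  0.\<close>

lemma shift_count:
  assumes X: "X \<subseteq> positions" and idx: "\<And>a b. 1 \<le> a \<Longrightarrow> 1 \<le> b \<Longrightarrow>
      ladder_index l (a + r, b + c) = ladder_index l (a, b) + k"
  shows "card {z \<in> ladder_positions l m. r < fst z \<and> c < snd z \<and> (fst z - r, snd z - c) \<in> X} =
    card {z \<in> X. ladder_index l z = m - k}" (is "card ?A = card ?B")
proof -
  have "bij_betw (\<lambda>z. (fst z - r, snd z - c)) ?A ?B"
  proof (rule bij_betw_byWitness[where f' = "\<lambda>z. (fst z + r, snd z + c)"])
    show "(\<lambda>z. (fst z - r, snd z - c)) ` ?A \<subseteq> ?B"
    proof clarsimp
      fix a b assume "(a, b) \<in> ladder_positions l m" "r < a" "c < b" "(a - r, b - c) \<in> X"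
      then show "ladder_index l (a - r, b - c) = m - k"
        using idx[of "a - r" "b - c"] by (auto simp: ladder_positions_def)
    qed
    show "(\<lambda>z. (fst z + r, snd z + c)) ` ?B \<subseteq> ?A"
    proof clarsimp
      fix a b assume ab: "(a, b) \<in> X" "ladder_index l (a, b) = m - k"
      then have pos: "1 \<le> a" "1 \<le> b" using X by (auto simp: positions_def)
      then have "1 \<le> m - k" using ab(2) by (auto simp: ladder_index_def)
      then have "ladder_index l (a + r, b + c) = m" using idx[OF pos] ab(2) by simp
      then show "(a + r, b + c) \<in> ladder_positions l m \<and> 0 < a \<and> 0 < b"
        using pos by (auto simp: ladder_positions_def positions_def)
    qed
  qed auto
  then show ?thesis by (rule bij_betw_same_card)
qed

text \<open>
  A position is addable or occupied iff the two positions above and to the left of it are occupied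
  or outside of the quadrant. Count by inclusion and exclusion: at least one of these two is
  occupied iff the diagonal predecessor is occupied and not removable.
\<close>

lemma ladder_count:
  assumes "2 \<le> l"
  obtains c where "\<And>lam. is_partition lam \<Longrightarrow>
    int (card (ladder_addables l lam m)) - int (card (ladder_removables l lam (m - l))) =
    c + int (content l lam (m - 1)) + int (content l lam (m - (l - 1)))
      - int (content l lam (m - l)) - int (content l lam m)"
proof
  let ?L = "ladder_positions l m"
  \<comment> \<open>The contribution of neighbours outside the quadrant. The summand is 1 at
    \<open>(1, 1)\<close> and 0 elsewhere, but only its independence of \<open>lam\<close>
    matters.\<close>
  let ?c = "\<Sum>z\<in>?L. of_bool (fst z = 1) + of_bool (snd z = 1) - of_bool (fst z = 1 \<or> snd z = 1) :: int"
  fix lam assume lam: "is_partition lam"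
  have fin: "finite ?L" by (rule finite_ladder_positions[OF assms])
  \<comment> \<open>The upper neighbour, the left neighbour and the diagonal predecessor are
    occupied, respectively the last is removable. Guards \<open>0 <\<close> and subtractions of 0
    give the shape required by \<open>shift_count\<close>.\<close>
  define U where "U = {z. 1 < fst z \<and> 0 < snd z \<and> (fst z - 1, snd z - 0) \<in> lam}"
  define V where "V = {z. 0 < fst z \<and> 1 < snd z \<and> (fst z - 0, snd z - 1) \<in> lam}"
  define W where "W = {z. 1 < fst z \<and> 1 < snd z \<and> (fst z - 1, snd z - 1) \<in> lam}"
  define R where "R = {z. 1 < fst z \<and> 1 < snd z \<and>
    (fst z - 1, snd z - 1) \<in> {p. removable lam p}}"
  have pt: "of_bool (addable lam z) =
      (of_bool (fst z = 1) + of_bool (snd z = 1) - of_bool (fst z = 1 \<or> snd z = 1)) +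
      of_bool (z \<in> U) + of_bool (z \<in> V) - of_bool (z \<in> W) + of_bool (z \<in> R) -
      (of_bool (z \<in> lam) :: int)" if "z \<in> ?L" for z
  proof -
    obtain a b where z: "z = (a, b)" by force
    have ab: "1 \<le> a" "1 \<le> b" using that z by (auto simp: ladder_positions_def positions_def)
    note add = addable_iff[OF lam, of a b]
    have *: "(a - 1, b) \<in> lam" if "(a, b) \<in> lam" "a \<noteq> 1"
      using partition_mono[OF lam that(1), of "a - 1" b] ab that(2) by simp
    have **: "(a, b - 1) \<in> lam" if "(a, b) \<in> lam" "b \<noteq> 1"
      using partition_mono[OF lam that(1), of a "b - 1"] ab that(2) by simp
    show ?thesis
    proof (cases "a = 1 \<or> b = 1")
      case True
      then show ?thesis
        using ab * ** by (auto simp: z add U_def V_def W_def R_def)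
    next
      case False
      then have gt: "1 < a" "1 < b" using ab by auto
      have rem: "removable lam (a - 1, b - 1) \<longleftrightarrow>
          (a - 1, b - 1) \<in> lam \<and> (a, b - 1) \<notin> lam \<and> (a - 1, b) \<notin> lam"
        using removable_iff[OF lam, of "a - 1" "b - 1"] gt by simp
      have "(a - 1, b - 1) \<in> lam" if "(a, b - 1) \<in> lam \<or> (a - 1, b) \<in> lam"
        using partition_mono[OF lam, of a "b - 1" "a - 1" "b - 1"]
          partition_mono[OF lam, of "a - 1" b "a - 1" "b - 1"] that gt by auto
      then show ?thesis
        using gt * ** False by (auto simp: z add rem U_def V_def W_def R_def simp del: One_nat_def)
    qed
  qed
  have card_sum: "(\<Sum>z\<in>?L. of_bool (z \<in> X)) = int (card {z \<in> ?L. z \<in> X})" for X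
    using fin by (simp add: of_bool_def sum.If_cases Int_def)
  have "{z \<in> ?L. addable lam z} = ladder_addables l lam m"
    by (auto simp: ladder_addables_def ladder_positions_def addable_positions)
  moreover have "{z \<in> ?L. z \<in> lam} = {z \<in> lam. ladder_index l z = m}"
    using partition_subset[OF lam] by (auto simp: ladder_positions_def)
  moreover have "card {z \<in> ?L. z \<in> U} = content l lam (m - 1)"
    unfolding U_def mem_Collect_eq content_def
    by (rule shift_count[OF partition_subset[OF lam]]) (simp add: ladder_index_def)
  moreover have "card {z \<in> ?L. z \<in> V} = content l lam (m - (l - 1))"
    unfolding V_def mem_Collect_eq content_def
    by (rule shift_count[OF partition_subset[OF lam]]) (simp add: ladder_index_Suc_column)
  moreover have diag: "ladder_index l (a + 1, b + 1) = ladder_index l (a, b) + l"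
    if "1 \<le> b" for a b
    using that assms by (simp add: ladder_index_Suc_row ladder_index_Suc_column)
  moreover have "card {z \<in> ?L. z \<in> W} = content l lam (m - l)"
    unfolding W_def mem_Collect_eq content_def
    by (rule shift_count[OF partition_subset[OF lam]]) (rule diag)
  moreover have "card {z \<in> ?L. z \<in> R} = card (ladder_removables l lam (m - l))"
  proof -
    have "{p. removable lam p} \<subseteq> positions" using removable_positions[OF lam] by blast
    from shift_count[OF this, of l 1 1 l m] diag show ?thesis
      unfolding R_def ladder_removables_def by simp
  qed
  ultimately show "int (card (ladder_addables l lam m)) - int (card (ladder_removables l lam (m - l))) =
    ?c + int (content l lam (m - 1)) + int (content l lam (m - (l - 1)))
      - int (content l lam (m - l)) - int (content l lam m)"
    using sum.cong[OF refl pt, of ?L] card_sum[of "{z. addable lam z}"]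
      card_sum[of U] card_sum[of V] card_sum[of W] card_sum[of R] card_sum[of lam]
    by (simp add: sum.distrib sum_subtractf content_def)
qed

text \<open>Below \<open>l\<close> there is no preceding ladder of the same residue; there truncation gives index
  \<open>0\<close>, and no position has this index.\<close>

lemma height_step:
  assumes lam: "is_partition lam" and l: "2 \<le> l" and i: "ladder_residue l m = i" and m: "1 \<le> m"
  shows "height l i lam m = height l i lam (m - l) +
    int (card (ladder_addables l lam m)) - int (card (ladder_removables l lam (m - l)))"
proof -
  \<comment> \<open>Indices of residue \<open>i\<close> are congruent to \<open>m\<close> modulo
    \<open>l\<close>, so none lies strictly between \<open>m - l\<close> and
    \<open>m\<close>.\<close>
  have gap: "ladder_index l p \<le> m - l \<or> ladder_index l p \<ge> m"
    if "residue l p = i" "p \<in> positions" for p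
  proof (rule ccontr)
    assume n: "\<not> ?thesis"
    have "m mod l = ladder_index l p mod l"
      using that i l residue_ladder[of l p] ladder_residue_eq_iff[of l "ladder_index l p" m] by simp
    then have "l dvd m - ladder_index l p"
      using n by (subst mod_eq_dvd_iff_nat[symmetric]) auto
    moreover have "0 < m - ladder_index l p" using n by simp
    ultimately have "l \<le> m - ladder_index l p" by (rule dvd_imp_le)
    then show False using n by linarith
  qed
  have on: "residue l p = i" if "p \<in> positions" "ladder_index l p = m" for p
    using that i l residue_ladder[of l p] by simp
  have on': "residue l p = i" if "p \<in> positions" "ladder_index l p = m - l" for p
  proof -
    have "l \<le> m" using that ladder_index_pos[of p l] by linarith
    then have "(m - l) mod l = m mod l" using le_mod_geq[of l m] by simp
    then show ?thesis
      using that i l residue_ladder[of l p] ladder_residue_eq_iff[of l "m - l" m] by simp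
  qed
  have "{p. addable lam p \<and> residue l p = i \<and> ladder_index l p \<le> m} =
      {p. addable lam p \<and> residue l p = i \<and> ladder_index l p \<le> m - l} \<union> ladder_addables l lam m"
    using gap on addable_positions by (fastforce simp: ladder_addables_def)
  moreover have "{p. addable lam p \<and> residue l p = i \<and> ladder_index l p \<le> m - l} \<inter>
      ladder_addables l lam m = {}"
    using l m by (auto simp: ladder_addables_def)
  moreover have "finite (ladder_addables l lam m)"
    unfolding ladder_addables_def by (rule finite_addable[OF lam])
  ultimately have A: "card {p. addable lam p \<and> residue l p = i \<and> ladder_index l p \<le> m} =
      card {p. addable lam p \<and> residue l p = i \<and> ladder_index l p \<le> m - l} +
      card (ladder_addables l lam m)"
    using finite_addable[OF lam] by (simp add: card_Un_disjoint)
  have "{p. removable lam p \<and> residue l p = i \<and> ladder_index l p < m} =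
      {p. removable lam p \<and> residue l p = i \<and> ladder_index l p < m - l} \<union>
      ladder_removables l lam (m - l)"
    using gap on' removable_positions[OF lam] l m
    by (fastforce simp: ladder_removables_def)
  moreover have "{p. removable lam p \<and> residue l p = i \<and> ladder_index l p < m - l} \<inter>
      ladder_removables l lam (m - l) = {}"
    by (auto simp: ladder_removables_def)
  moreover have "finite (ladder_removables l lam (m - l))"
    unfolding ladder_removables_def by (rule finite_removable[OF lam])
  ultimately have B: "card {p. removable lam p \<and> residue l p = i \<and> ladder_index l p < m} =
      card {p. removable lam p \<and> residue l p = i \<and> ladder_index l p < m - l} +
      card (ladder_removables l lam (m - l))"
    using finite_removable[OF lam] by (simp add: card_Un_disjoint)
  show ?thesis unfolding height_def A B by simp
qed

lemma height_zero:
  assumes "is_partition lam"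
  shows "height l i lam 0 = 0"
proof -
  have "ladder_index l p \<noteq> 0" if "addable lam p" for p
    using ladder_index_pos[OF addable_positions[OF that], of l] by simp
  then have "{p. addable lam p \<and> residue l p = i \<and> ladder_index l p \<le> 0} = {}" by auto
  then show ?thesis unfolding height_def by (simp only: card.empty) simp
qed

text \<open>For \<open>e = 0\<close> this says that the heights are determined by the content alone.\<close>

lemma height_content:
  assumes lam: "is_partition lam" and mu: "is_partition mu" and l: "2 \<le> l"
    and content: "\<And>m. content l mu m = content l lam m + e * of_bool (m = n)"
    and n: "ladder_residue l n = i" and m: "ladder_residue l m = i" "1 \<le> n" "1 \<le> m"
  shows "height l i lam m = height l i mu m + int e * (of_bool (n \<le> m) + of_bool (n < m))"
  using m
proof (induction m rule: less_induct)
  case (less m)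
  have mod: "m mod l = n mod l" using less.prems n l ladder_residue_eq_iff[of l m n] by simp
  obtain c where c: "\<And>lam. is_partition lam \<Longrightarrow>
    int (card (ladder_addables l lam m)) - int (card (ladder_removables l lam (m - l))) =
    c + int (content l lam (m - 1)) + int (content l lam (m - (l - 1)))
      - int (content l lam (m - l)) - int (content l lam m)"
    using ladder_count[OF l] by blast
  \<comment> \<open>Neither 1 nor \<open>l - 1\<close> is a multiple of \<open>l\<close>. So of the
    four contents in the count only those of ladders \<open>m\<close> and \<open>m - l\<close> can
    change; both enter with a minus sign, which yields the two summands of the correction.\<close>
  have neq: "m - 1 \<noteq> n" "m - (l - 1) \<noteq> n"
  proof -
    have "\<not> l dvd k" if "0 < k" "k < l" for k using that by (auto dest: dvd_imp_le)
    from this[of 1] this[of "l - 1"] have nd: "\<not> l dvd 1" "\<not> l dvd l - 1" using l by auto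
    show "m - 1 \<noteq> n"
    proof
      assume "m - 1 = n"
      then have "n \<le> m" "m - n = 1" using less.prems by auto
      then show False using mod nd(1) by (simp add: mod_eq_dvd_iff_nat)
    qed
    show "m - (l - 1) \<noteq> n"
    proof
      assume "m - (l - 1) = n"
      then have "n \<le> m" "m - n = l - 1" using less.prems by auto
      then show False using mod nd(2) by (simp add: mod_eq_dvd_iff_nat)
    qed
  qed
  have prev: "height l i lam (m - l) = height l i mu (m - l) +
      int e * (of_bool (n \<le> m - l) + of_bool (n < m - l))"
  proof (cases "m \<le> l")
    case True
    then show ?thesis using less.prems by (simp add: height_zero lam mu)
  next
    case False
    then have "ladder_residue l (m - l) = i"
      using less.prems l ladder_residue_eq_iff[of l "m - l" m] le_mod_geq[of l m] by simp
    then show ?thesis using less False l by simp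
  qed
  have between: "n < m \<longleftrightarrow> n \<le> m - l"
  proof
    assume "n < m"
    then have "l dvd m - n" using mod by (simp add: mod_eq_dvd_iff_nat)
    then have "l \<le> m - n" using \<open>n < m\<close> by (intro dvd_imp_le) auto
    then show "n \<le> m - l" using \<open>n < m\<close> by linarith
  qed (use l less.prems in linarith)
  have count: "of_bool (n \<le> m) + of_bool (n < m) =
      of_bool (n \<le> m - l) + of_bool (n < m - l) + of_bool (m = n) + (of_bool (m - l = n) :: int)"
  proof (cases "n < m")
    case True
    then show ?thesis using between by (cases "m - l = n") auto
  next
    case False
    then show ?thesis using between by (cases "m = n") auto
  qed
  have eq: "content l mu (m - 1) = content l lam (m - 1)"
    "content l mu (m - (l - 1)) = content l lam (m - (l - 1))"
    using neq content by simp_all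
  have "height l i lam m - height l i lam (m - l) - (height l i mu m - height l i mu (m - l)) =
      int (content l mu (m - l)) - int (content l lam (m - l)) +
      (int (content l mu m) - int (content l lam m))"
    using height_step[OF lam l less.prems(1,3)] height_step[OF mu l less.prems(1,3)]
      c[OF lam] c[OF mu] eq by linarith
  also have "\<dots> = int e * (of_bool (m - l = n) + of_bool (m = n))"
    by (simp add: content distrib_left)
  finally show ?case unfolding count using prev by (simp add: distrib_left)
qed

lemma ladder_index_less: "c < a \<Longrightarrow> d \<le> b \<Longrightarrow> ladder_index l (c, d) < ladder_index l (a, b)"
  by (simp add: ladder_index_def add_less_le_mono diff_le_mono)

lemma ladder_index_column_less:
  assumes "1 \<le> d" "d < b"
  shows "ladder_index l (c, d) + (l - 1) \<le> ladder_index l (c, b)"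
proof -
  have "(l - 1) * d \<le> (l - 1) * (b - 1)" using assms by (intro mult_le_mono2) linarith
  then show ?thesis using assms by (cases d) (auto simp: ladder_index_def)
qed

lemma ladder_same_row:
  assumes "2 \<le> l" "1 \<le> b" "1 \<le> d" "ladder_index l (a, b) = ladder_index l (a, d)"
  shows "b = d"
  using assms ladder_index_column_less[of b d l a] ladder_index_column_less[of d b l a]
  by (cases b d rule: linorder_cases) auto

lemma ladder_above_right:
  assumes "ladder_index l (c, d) = ladder_index l (a, b)" "c < a"
  shows "b < d"
  using ladder_index_less[OF assms(2), of d b l] assms(1) by linarith

lemma letters_Plus: "(Plus, p) \<in> letters l i lam \<longleftrightarrow> addable lam p \<and> residue l p = i"
  and letters_Minus: "(Minus, p) \<in> letters l i lam \<longleftrightarrow> removable lam p \<and> residue l p = i"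
  unfolding letters_def by blast+

lemma letters_positions: "is_partition lam \<Longrightarrow> (s, p) \<in> letters l i lam \<Longrightarrow> p \<in> positions"
  by (auto simp: letters_def addable_positions removable_positions)

lemma sorted_sign_key:
  assumes "sorted (map k w)"
    and "\<And>x y. x \<in> set w \<Longrightarrow> y \<in> set w \<Longrightarrow> k x \<le> k y \<Longrightarrow> sign_key l x \<le> sign_key l y"
  shows "sorted (map (sign_key l) w)"
  unfolding sorted_map
  by (rule sorted_wrt_mono_rel[OF _ assms(1)[unfolded sorted_map]]) (rule assms(2))


section \<open>Top-justified diagrams and the classical operators\<close>

text \<open>For a partition this amounts to every ladder being filled from the top: move
  \<open>(c, d)\<close> down its column to the ladder of \<open>(a, b)\<close>; if this ends below
  row \<open>a\<close>, then \<open>d < b\<close>. The form with an inequality applies directly to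
  boxes on different ladders.\<close>

definition top_justified :: "nat \<Rightarrow> pos set \<Rightarrow> bool" where
  "top_justified l mu \<longleftrightarrow> (\<forall>a b c d. (a, b) \<in> mu \<longrightarrow> 1 \<le> c \<longrightarrow> 1 \<le> d \<longrightarrow> c \<le> a \<longrightarrow>
     ladder_index l (c, d) \<le> ladder_index l (a, b) \<longrightarrow> (c, d) \<in> mu)"

lemma top_justifiedD:
  "top_justified l mu \<Longrightarrow> (a, b) \<in> mu \<Longrightarrow> 1 \<le> c \<Longrightarrow> 1 \<le> d \<Longrightarrow> c \<le> a \<Longrightarrow>
     ladder_index l (c, d) \<le> ladder_index l (a, b) \<Longrightarrow> (c, d) \<in> mu"
  unfolding top_justified_def by blast

text \<open>Suppose a lower letter had the larger index. Equal residues make the gap at least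
  \<open>l\<close>, so \<open>(c, Suc d)\<close>, just right of the upper letter, is still on an
  earlier ladder than \<open>(a, b)\<close>. Then top-justification forces it into
  \<open>mu\<close>, but no addable or removable position has a box to its right.\<close>

lemma signature_sorted:
  assumes mu: "is_partition mu" and top: "top_justified l mu" and l: "2 \<le> l"
  shows "sorted (map (sign_key l) (signature l i mu))"
proof (rule sorted_sign_key)
  show "sorted (map row_key (signature l i mu))"
    using signature_enumerates[OF mu l] by blast
  fix x y assume "x \<in> set (signature l i mu)" "y \<in> set (signature l i mu)"
    and key: "row_key x \<le> row_key y"
  then have xy: "x \<in> letters l i mu" "y \<in> letters l i mu"
    using signature_enumerates[OF mu l] by auto
  obtain s a b where x: "x = (s, (a, b))" by (metis prod.exhaust)
  obtain t c d where y: "y = (t, (c, d))" by (metis prod.exhaust)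
  have pos: "1 \<le> a" "1 \<le> b" "1 \<le> c" "1 \<le> d"
    using letters_positions[OF mu] xy x y by (auto simp: positions_def)
  have res: "ladder_index l (a, b) mod l = ladder_index l (c, d) mod l"
  proof -
    have "residue l (a, b) = i" "residue l (c, d) = i" using xy x y by (auto simp: letters_def)
    then show ?thesis
      using letters_positions[OF mu] xy x y l residue_ladder[of l "(a, b)"]
        residue_ladder[of l "(c, d)"] ladder_residue_eq_iff[of l "ladder_index l (a, b)"] by simp
  qed
  show "sign_key l x \<le> sign_key l y"
  proof (cases "a = c")
    case True
    then have "row_key x = row_key y" by (simp add: row_key_def x y)
    then have "x = y" using inj_row_key[OF mu l] xy by (meson inj_onD)
    then show ?thesis by simp
  next
    case False
    then have ca: "c < a" using key by (simp add: row_key_def x y)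
    have out: "(c, Suc d) \<notin> mu"
    proof (cases t)
      case Plus
      then have "(c, d) \<notin> mu" using xy y addable_iff[OF mu] by (simp add: letters_Plus)
      then show ?thesis using partition_mono[OF mu, of c "Suc d" c d] pos by auto
    qed (use xy y removable_iff[OF mu] in \<open>simp add: letters_Minus\<close>)
    have le: "ladder_index l (a, b) \<le> ladder_index l (c, d)"
    proof (rule ccontr)
      assume n: "\<not> ?thesis"
      then have "l dvd ladder_index l (a, b) - ladder_index l (c, d)"
        using res by (subst mod_eq_dvd_iff_nat[symmetric]) auto
      then have "l \<le> ladder_index l (a, b) - ladder_index l (c, d)"
        using n by (intro dvd_imp_le) auto
      then have gap: "ladder_index l (c, Suc d) + 1 \<le> ladder_index l (a, b)"
        using ladder_index_Suc_column[OF pos(4), of l c] l n by linarith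
      have "(c, Suc d) \<in> mu"
      proof (cases s)
        case Plus
        then have "(a - 1, b) \<in> mu"
          using xy x ca pos addable_iff[OF mu, of a b] by (auto simp: letters_Plus)
        moreover have "ladder_index l (a, b) = Suc (ladder_index l (a - 1, b))"
          using ladder_index_Suc_row[of l "a - 1" b] pos by simp
        ultimately show ?thesis
          using top_justifiedD[OF top, of "a - 1" b c "Suc d"] gap ca pos by simp
      next
        case Minus
        then have "(a, b) \<in> mu"
          using xy x removable_iff[OF mu, of a b] by (auto simp: letters_Minus)
        then show ?thesis
          using top_justifiedD[OF top, of a b c "Suc d"] gap ca pos by simp
      qed
      then show False using out by simp
    qed
    moreover have False
      if "s = Minus" "t = Plus" "ladder_index l (a, b) = ladder_index l (c, d)"
    proof -
      have "(a, b) \<in> mu" "(c, d) \<notin> mu"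
        using xy x y that removable_iff[OF mu] addable_iff[OF mu]
        by (auto simp: letters_Plus letters_Minus)
      then show False using top_justifiedD[OF top, of a b c d] that ca pos by simp
    qed
    ultimately show ?thesis by (cases s; cases t) (auto simp: sign_key_def x y le_less)
  qed
qed

text \<open>The word runs from bottom to top, so the last plus of a ladder is its topmost
  one.\<close>

lemma f_tilde_SomeE:
  assumes mu: "is_partition mu" and top: "top_justified l mu" and l: "2 \<le> l"
    and "f_tilde l i mu = Some mu'"
  obtains p where "mu' = insert p mu" "addable mu p" "residue l p = i"
    "0 < height l i mu (ladder_index l p)"
    "\<And>m. height l i mu m \<le> height l i mu (ladder_index l p)"
    "\<And>m. m < ladder_index l p \<Longrightarrow> height l i mu m < height l i mu (ladder_index l p)"
    "\<And>q. addable mu q \<Longrightarrow> ladder_index l q = ladder_index l p \<Longrightarrow> fst p \<le> fst q"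
proof -
  note enum = signature_enumerates[OF mu l]
  obtain u p v where w: "signature l i mu = u @ (Plus, p) # v" and p: "mu' = insert p mu"
      "addable mu p" "residue l p = i"
      "0 < height l i mu (ladder_index l p)"
      "\<And>m. height l i mu m \<le> height l i mu (ladder_index l p)"
      "\<And>m. m < ladder_index l p \<Longrightarrow> height l i mu m < height l i mu (ladder_index l p)"
      and v: "\<And>q. (Plus, q) \<in> set v \<Longrightarrow> ladder_index l q \<noteq> ladder_index l p"
    by (rule add_rightmost_SomeD[OF _ _ signature_sorted[OF mu top l, of i]])
      (use enum[of i] assms(4) in \<open>auto simp: f_tilde_def\<close>)
  have "fst p \<le> fst q" if q: "addable mu q" "ladder_index l q = ladder_index l p" for q
  proof -
    have "residue l q = residue l p"
      using q residue_ladder[of l] addable_positions p(2) l by simp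
    then have "(Plus, q) \<in> set (signature l i mu)"
      using enum q p(3) by (simp add: letters_Plus)
    then have "(Plus, q) \<in> set u \<or> q = p" using w v[of q] q(2) by auto
    moreover have "row_key x \<le> row_key (Plus, p)" if "x \<in> set u" for x
      using enum[of i] that by (simp add: w sorted_append)
    ultimately have "row_key (Plus, q) \<le> row_key (Plus, p)" by blast
    then show ?thesis by (cases p; cases q) (simp add: row_key_def)
  qed
  with that[of p] p show thesis by blast
qed

lemma f_tilde_NoneD:
  assumes "is_partition mu" "top_justified l mu" "2 \<le> l" "f_tilde l i mu = None"
  shows "height l i mu m \<le> 0"
  using add_rightmost_NoneD[of "signature l i mu"] signature_enumerates[OF assms(1,3)]
    signature_sorted[OF assms(1-3)] assms(4) unfolding f_tilde_def by blast

text \<open>Positions on earlier ladders are secured by the box above \<open>p\<close>. An empty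
  position higher up on the ladder of \<open>p\<close> would have its upper and left neighbours on
  earlier ladders, hence be addable, against the choice of \<open>p\<close>.\<close>

lemma top_justified_insert:
  assumes mu: "is_partition mu" and top: "top_justified l mu" and l: "2 \<le> l"
    and p: "addable mu p"
    and topmost: "\<And>q. addable mu q \<Longrightarrow> ladder_index l q = ladder_index l p \<Longrightarrow> fst p \<le> fst q"
  shows "top_justified l (insert p mu)"
proof -
  obtain a b where ab: "p = (a, b)" by force
  have A: "(a, b) \<notin> mu" "1 \<le> a" "1 \<le> b" "a = 1 \<or> (a - 1, b) \<in> mu" "b = 1 \<or> (a, b - 1) \<in> mu"
    using p addable_iff[OF mu, of a b] by (auto simp: ab)
  have up: "ladder_index l (a, b) = Suc (ladder_index l (a - 1, b))"
    using ladder_index_Suc_row[of l "a - 1" b] A by simp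
  have new: "(c, d) \<in> insert p mu"
    if cd: "1 \<le> c" "1 \<le> d" "c \<le> a" "ladder_index l (c, d) \<le> ladder_index l (a, b)" for c d
  proof (cases "c = a")
    case True
    then have "d \<le> b"
      using cd ladder_index_column_less[of b d l a] A l by (cases "d \<le> b") auto
    then show ?thesis
      using A True cd partition_mono[OF mu, of a "b - 1" a d] by (cases "d = b") (auto simp: ab)
  next
    case False
    then have ca: "c \<le> a - 1" "1 < a" using cd by auto
    then have above: "(a - 1, b) \<in> mu" using A by auto
    show ?thesis
    proof (cases "ladder_index l (c, d) = ladder_index l (a, b)")
      case True
      have "b < d" using ladder_above_right[OF True] ca by simp
      have "addable mu (c, d)" if "(c, d) \<notin> mu"
      proof -
        have "(c - 1, d) \<in> mu" if "c \<noteq> 1"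
          using top_justifiedD[OF top above, of "c - 1" d] ladder_index_Suc_row[of l "c - 1" d]
            that cd ca True up by simp
        moreover have "(c, d - 1) \<in> mu"
        proof -
          have d: "1 \<le> d - 1" "Suc (d - 1) = d" using \<open>b < d\<close> A by linarith+
          have "ladder_index l (c, d - 1) \<le> ladder_index l (a - 1, b)"
            using ladder_index_Suc_column[OF d(1), of l c] True up l unfolding d(2) by linarith
          then show ?thesis using top_justifiedD[OF top above cd(1) d(1)] ca by simp
        qed
        ultimately show ?thesis using that cd addable_iff[OF mu, of c d] by blast
      qed
      moreover have "\<not> addable mu (c, d)"
        using topmost[of "(c, d)"] True ca by (auto simp: ab)
      ultimately show ?thesis by blast
    next
      case False
      then show ?thesis using top_justifiedD[OF top above, of c d] up cd ca by simp
    qed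
  qed
  show ?thesis
    unfolding top_justified_def
  proof (intro allI impI)
    fix a' b' c d
    assume *: "(a', b') \<in> insert p mu" "1 \<le> c" "1 \<le> d" "c \<le> a'"
      "ladder_index l (c, d) \<le> ladder_index l (a', b')"
    show "(c, d) \<in> insert p mu"
    proof (cases "(a', b') = p")
      case True
      then show ?thesis using new[of c d] * by (simp add: ab)
    next
      case False
      then have "(a', b') \<in> mu" using *(1) by simp
      then show ?thesis using top_justifiedD[OF top _ *(2-5)] by simp
    qed
  qed
qed

text \<open>On a ladder with equally many boxes, a box of \<open>mu\<close> missing in
  \<open>nu\<close> is matched by one of \<open>nu\<close> missing in \<open>mu\<close>. The lower
  of the two forces the higher one into its own diagram.\<close>

lemma top_justified_unique:
  assumes mu: "is_partition mu" "top_justified l mu" and nu: "is_partition nu" "top_justified l nu"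
    and l: "2 \<le> l" and content: "content l mu = content l nu"
  shows "mu \<subseteq> nu"
proof (rule ccontr)
  assume "\<not> mu \<subseteq> nu"
  then obtain a b where x: "(a, b) \<in> mu" "(a, b) \<notin> nu" by auto
  let ?A = "\<lambda>lam. {z \<in> lam. ladder_index l z = ladder_index l (a, b)}"
  have "card (?A mu) = card (?A nu)"
    using fun_cong[OF content, of "ladder_index l (a, b)"] by (simp add: content_def)
  moreover have "finite (?A mu)" using partition_finite[OF mu(1)] by simp
  ultimately have "\<not> ?A nu \<subset> ?A mu" using psubset_card_mono[of "?A mu" "?A nu"] by linarith
  moreover have "(a, b) \<in> ?A mu" "(a, b) \<notin> ?A nu" using x by auto
  ultimately obtain z where "z \<in> ?A nu" "z \<notin> ?A mu" by blast
  then obtain c d where y: "(c, d) \<in> nu" "(c, d) \<notin> mu"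
      "ladder_index l (c, d) = ladder_index l (a, b)"
    by (cases z) auto
  show False
  proof (cases "c \<le> a")
    case True
    then show False
      using top_justifiedD[OF mu(2) x(1), of c d] y partition_posD[OF nu(1) y(1)] by simp
  next
    case False
    then show False
      using top_justifiedD[OF nu(2) y(1), of a b] x y partition_posD[OF mu(1) x(1)] by simp
  qed
qed

text \<open>The next position up the ladder of \<open>(a, b)\<close> is
  \<open>(a - (l - 1), b + 1)\<close>. If it is empty although \<open>(a, b)\<close> is a box, then
  the \<open>l\<close> rows from \<open>a - (l - 1)\<close> to \<open>a\<close> all have length
  \<open>b\<close>; conversely, \<open>l\<close> equal parts leave such a gap.\<close>

lemma regular_iff_top_justified:
  assumes mu: "is_partition mu" and l: "2 \<le> l"
  shows "regular l mu \<longleftrightarrow> top_justified l mu"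
proof -
  have row: "{b. (a, b) \<in> mu} = {1..part mu a}" for a
  proof -
    let ?R = "{b. (a, b) \<in> mu}"
    have fin: "finite ?R"
      by (rule finite_subset[of _ "snd ` mu"]) (use partition_finite[OF mu] in force)+
    have "?R = {1..card ?R}"
    proof (cases "?R = {}")
      case False
      have "?R = {1..Max ?R}"
      proof (intro equalityI subsetI)
        fix b assume b: "b \<in> {1..Max ?R}"
        have M: "(a, Max ?R) \<in> mu" using Max_in[OF fin False] by blast
        have "(a, b) \<in> mu"
          by (rule partition_mono[OF mu M]) (use b partition_posD[OF mu M] in simp_all)
        then show "b \<in> ?R" by blast
      next
        fix b assume "b \<in> ?R"
        then show "b \<in> {1..Max ?R}" using Max_ge[OF fin] partition_posD[OF mu, of a b] by simp
      qed
      then have "card ?R = Max ?R" by (metis card_atLeastAtMost diff_Suc_1)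
      then show ?thesis using \<open>?R = {1..Max ?R}\<close> by simp
    qed simp
    then show ?thesis by (simp only: part_def)
  qed
  have in_iff: "(a, b) \<in> mu \<longleftrightarrow> 1 \<le> b \<and> b \<le> part mu a" for a b
    using row[of a] by (metis atLeastAtMost_iff mem_Collect_eq)
  have anti: "part mu a \<le> part mu c" if "1 \<le> c" "c \<le> a" for a c
  proof (cases "part mu a = 0")
    case False
    then have "(a, part mu a) \<in> mu" using in_iff by simp
    then have "(c, part mu a) \<in> mu"
      by (rule partition_mono[OF mu]) (use that False in simp_all)
    then show ?thesis using in_iff by simp
  qed simp
  have step: "ladder_index l (a - (l - 1), b + 1) = ladder_index l (a, b)"
    if "l \<le> a" "1 \<le> b" for a b
    using that ladder_index_Suc_column[of b l "a - (l - 1)"] by (simp add: ladder_index_def)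
  show ?thesis
  proof
    assume reg: "regular l mu"
    have up: "(a - (l - 1), b + 1) \<in> mu" if ab: "(a, b) \<in> mu" "l \<le> a" for a b
    proof (rule ccontr)
      assume n: "(a - (l - 1), b + 1) \<notin> mu"
      have "part mu c = b" if "c \<in> {a - (l - 1)..a}" for c
      proof (rule antisym)
        have c: "a - (l - 1) \<le> c" "c \<le> a" "1 \<le> a - (l - 1)" using that ab l by auto
        have "part mu (a - (l - 1)) \<le> b" using n in_iff[of "a - (l - 1)" "b + 1"] by simp
        then show "part mu c \<le> b" using anti[OF c(3,1)] by simp
        show "b \<le> part mu c" using anti[OF _ c(2)] c in_iff[of a b] ab by simp
      qed
      then have sub: "{a - (l - 1)..a} \<subseteq> {c. part mu c = b}" by blast
      have b: "1 \<le> b" using partition_posD[OF mu] ab by blast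
      have "{c. part mu c = b} \<subseteq> fst ` mu"
      proof
        fix c assume "c \<in> {c. part mu c = b}"
        then have "(c, b) \<in> mu" using in_iff b by simp
        then show "c \<in> fst ` mu" by force
      qed
      then have "finite {c. part mu c = b}" using partition_finite[OF mu] finite_subset by blast
      then have "card {a - (l - 1)..a} \<le> card {c. part mu c = b}" using sub card_mono by blast
      then have "l \<le> card {c. part mu c = b}" using ab l by simp
      then show False using reg b unfolding regular_def by (metis not_le)
    qed
    have "(c, d) \<in> mu"
      if "(a, b) \<in> mu" "1 \<le> c" "1 \<le> d" "c \<le> a" "ladder_index l (c, d) \<le> ladder_index l (a, b)"
      for a b c d
      using that
    proof (induction a arbitrary: b rule: less_induct)
      case (less a)
      have b: "1 \<le> b" using partition_posD[OF mu] less.prems(1) by blast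
      show ?case
      proof (cases "a - c < l - 1")
        case True
        have "d \<le> b"
        proof (rule ccontr)
          assume "\<not> d \<le> b"
          then have "ladder_index l (c, b) + (l - 1) \<le> ladder_index l (a, b)"
            using ladder_index_column_less[of b d l c] b less.prems by linarith
          then show False using True by (simp add: ladder_index_def)
        qed
        then show ?thesis using partition_mono[OF mu less.prems(1)] less.prems by blast
      next
        case False
        then have "l \<le> a" "c \<le> a - (l - 1)" "a - (l - 1) < a"
          using less.prems l by auto
        then show ?thesis
          using less.IH[of "a - (l - 1)" "b + 1"] up[of a b] step[of a b] b less.prems by simp
      qed
    qed
    then show "top_justified l mu" unfolding top_justified_def by blast
  next
    assume top: "top_justified l mu"
    show "regular l mu"
      unfolding regular_def
    proof (intro allI impI)
      fix k :: nat assume k: "1 \<le> k"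
      show "card {a. part mu a = k} < l"
      proof (cases "{a. part mu a = k} = {}")
        case False
        let ?S = "{a. part mu a = k}"
        have mem: "(a, k) \<in> mu" if "a \<in> ?S" for a using in_iff k that by simp
        have "?S \<subseteq> fst ` mu" using mem by force
        then have fin: "finite ?S" using partition_finite[OF mu] finite_subset by blast
        let ?m = "Max ?S"
        have m: "?m \<in> ?S" using Max_in[OF fin False] .
        have "a \<in> {?m - (l - 2)..?m}" if a: "a \<in> ?S" for a
        proof (rule ccontr)
          assume "a \<notin> {?m - (l - 2)..?m}"
          moreover have "a \<le> ?m" using Max_ge[OF fin a] .
          ultimately have *: "a \<le> ?m - (l - 1)" "l - 1 \<le> ?m" using l by auto
          have "1 \<le> a" using partition_posD[OF mu mem[OF a]] by simp
          then have "l \<le> ?m" using * l by linarith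
          then have "(?m - (l - 1), k + 1) \<in> mu"
            using top_justifiedD[OF top mem[OF m]] step[of ?m k] k l by simp
          then have "(a, k + 1) \<in> mu"
            using partition_mono[OF mu, of "?m - (l - 1)" "k + 1" a "k + 1"] * \<open>1 \<le> a\<close> by simp
          then show False using in_iff[of a "k + 1"] a by simp
        qed
        then have "?S \<subseteq> {?m - (l - 2)..?m}" by blast
        then have "card ?S \<le> card {?m - (l - 2)..?m}" by (intro card_mono) auto
        also have "\<dots> < l" using l by simp
        finally show ?thesis .
      qed (use l in simp)
    qed
  qed
qed


section \<open>Locked diagrams and the ladder operators\<close>

text \<open>
  Let \<open>(c, y)\<close> be the last box of its row. If a lower position of its ladder has a box above it
  but is itself empty, then a final segment of row \<open>c\<close> could be moved down its ladders to the end
  of that lower row. In a locked diagram this never occurs.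
\<close>

definition locked :: "nat \<Rightarrow> pos set \<Rightarrow> bool" where
  "locked l lam \<longleftrightarrow> (\<forall>c y a b. (c, y) \<in> lam \<longrightarrow> (c, Suc y) \<notin> lam \<longrightarrow>
     ladder_index l (a, b) = ladder_index l (c, y) \<longrightarrow> c < a \<longrightarrow> 1 \<le> b \<longrightarrow> (a - 1, b) \<in> lam \<longrightarrow>
     (a, b) \<in> lam)"

lemma lockedD:
  "locked l lam \<Longrightarrow> (c, y) \<in> lam \<Longrightarrow> (c, Suc y) \<notin> lam \<Longrightarrow>
     ladder_index l (a, b) = ladder_index l (c, y) \<Longrightarrow> c < a \<Longrightarrow> 1 \<le> b \<Longrightarrow> (a - 1, b) \<in> lam \<Longrightarrow>
     (a, b) \<in> lam"
  unfolding locked_def by blast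

text \<open>The only bad order on a ladder is a minus above a plus. The minus ends its row and the
  plus has a box above it, so \<open>locked\<close> would make the plus a box.\<close>

lemma ladder_signature_sorted:
  assumes lam: "is_partition lam" and locked: "locked l lam" and l: "2 \<le> l"
  shows "sorted (map (sign_key l) (ladder_signature l i lam))"
proof (rule sorted_sign_key)
  show "sorted (map (ladder_key l) (ladder_signature l i lam))"
    using ladder_signature_enumerates[OF lam l] by blast
  fix x y assume "x \<in> set (ladder_signature l i lam)" "y \<in> set (ladder_signature l i lam)"
    and key: "ladder_key l x \<le> ladder_key l y"
  then have xy: "x \<in> letters l i lam" "y \<in> letters l i lam"
    using ladder_signature_enumerates[OF lam l] by auto
  obtain s a b where x: "x = (s, (a, b))" by (metis prod.exhaust)
  obtain t c d where y: "y = (t, (c, d))" by (metis prod.exhaust)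
  have cmp: "ladder_index l (a, b) < ladder_index l (c, d) \<or>
      ladder_index l (a, b) = ladder_index l (c, d) \<and> a \<le> c"
    using key by (auto simp: ladder_key_def x y)
  show "sign_key l x \<le> sign_key l y"
  proof (cases "ladder_index l (a, b) = ladder_index l (c, d) \<and> s = Minus \<and> t = Plus")
    case False
    then show ?thesis using cmp by (cases s; cases t) (auto simp: sign_key_def x y)
  next
    case True
    have rem: "(a, b) \<in> lam" "(a, Suc b) \<notin> lam"
      using True xy(1) x removable_iff[OF lam, of a b] by (simp_all add: letters_Minus)
    have add: "(c, d) \<notin> lam" "1 \<le> c" "1 \<le> d" "c = 1 \<or> (c - 1, d) \<in> lam"
      using True xy(2) y addable_iff[OF lam, of c d] by (simp_all add: letters_Plus)
    have "a \<noteq> c"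
    proof
      assume "a = c"
      then have "ladder_key l x = ladder_key l y" using True by (simp add: ladder_key_def x y)
      then have "x = y" using inj_ladder_key[OF lam l] xy by (meson inj_onD)
      then show False using True x y by simp
    qed
    then have "a < c" using True cmp by simp
    moreover have "c \<noteq> 1" using \<open>a < c\<close> partition_posD[OF lam rem(1)] by linarith
    ultimately show ?thesis
      using lockedD[OF locked rem, of c d] True add by simp
  qed
qed

lemma f_hat_SomeE:
  assumes lam: "is_partition lam" and locked: "locked l lam" and l: "2 \<le> l"
    and "f_hat l i lam = Some lam'"
  obtains p where "lam' = insert p lam" "addable lam p" "residue l p = i"
    "0 < height l i lam (ladder_index l p)"
    "\<And>m. height l i lam m \<le> height l i lam (ladder_index l p)"
    "\<And>m. m < ladder_index l p \<Longrightarrow> height l i lam m < height l i lam (ladder_index l p)"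
    "\<And>q. addable lam q \<Longrightarrow> ladder_index l q = ladder_index l p \<Longrightarrow> fst q \<le> fst p"
proof -
  note enum = ladder_signature_enumerates[OF lam l]
  obtain u p v where w: "ladder_signature l i lam = u @ (Plus, p) # v" and p: "lam' = insert p lam"
      "addable lam p" "residue l p = i"
      "0 < height l i lam (ladder_index l p)"
      "\<And>m. height l i lam m \<le> height l i lam (ladder_index l p)"
      "\<And>m. m < ladder_index l p \<Longrightarrow> height l i lam m < height l i lam (ladder_index l p)"
      and v: "\<And>q. (Plus, q) \<in> set v \<Longrightarrow> ladder_index l q \<noteq> ladder_index l p"
    by (rule add_rightmost_SomeD[OF _ _ ladder_signature_sorted[OF lam locked l, of i]])
      (use enum[of i] assms(4) in \<open>auto simp: f_hat_def\<close>)
  have "fst q \<le> fst p" if q: "addable lam q" "ladder_index l q = ladder_index l p" for q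
  proof -
    have "residue l q = residue l p"
      using q residue_ladder[of l] addable_positions p(2) l by simp
    then have "(Plus, q) \<in> set (ladder_signature l i lam)"
      using enum q p(3) by (simp add: letters_Plus)
    then have "(Plus, q) \<in> set u \<or> q = p" using w v[of q] q(2) by auto
    moreover have "ladder_key l x \<le> ladder_key l (Plus, p)" if "x \<in> set u" for x
      using enum[of i] that by (simp add: w sorted_append)
    ultimately have "ladder_key l (Plus, q) \<le> ladder_key l (Plus, p)" by blast
    then show ?thesis using q(2) by (simp add: ladder_key_def)
  qed
  with that[of p] p show thesis by blast
qed

lemma f_hat_NoneD:
  assumes "is_partition lam" "locked l lam" "2 \<le> l" "f_hat l i lam = None"
  shows "height l i lam m \<le> 0"
  using add_rightmost_NoneD[of "ladder_signature l i lam"] ladder_signature_enumerates[OF assms(1,3)]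
    ladder_signature_sorted[OF assms(1-3)] assms(4) unfolding f_hat_def by blast

text \<open>
  The only critical case is a position \<open>(a + 1, b)\<close> that gets its upper neighbour \<open>(a, b)\<close>, with
  a row ending at \<open>(c, y)\<close> higher on its ladder. Then \<open>(c, y + 1)\<close> is addable on the next ladder
  of the same residue, while the ladder of \<open>(a, b)\<close> has no removable box.
\<close>

lemma locked_insert:
  assumes lam: "is_partition lam" and locked: "locked l lam" and l: "3 \<le> l"
    and p: "addable lam p"
    and bottom: "\<And>q. addable lam q \<Longrightarrow> ladder_index l q = ladder_index l p \<Longrightarrow> fst q \<le> fst p"
    and next_ladder: "ladder_addables l lam (ladder_index l p + l) \<noteq> {} \<Longrightarrow>
      ladder_removables l lam (ladder_index l p) \<noteq> {}"
  shows "locked l (insert p lam)"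
  unfolding locked_def
proof (intro allI impI, rule ccontr)
  obtain a b where ab: "p = (a, b)" by force
  have A: "(a, b) \<notin> lam" "1 \<le> a" "1 \<le> b" "a = 1 \<or> (a - 1, b) \<in> lam" "b = 1 \<or> (a, b - 1) \<in> lam"
    using p addable_iff[OF lam, of a b] by (auto simp: ab)
  fix c y e g
  assume cy: "(c, y) \<in> insert p lam" "(c, Suc y) \<notin> insert p lam"
    and idx: "ladder_index l (e, g) = ladder_index l (c, y)" and ce: "c < e" and g: "1 \<le> g"
    and up: "(e - 1, g) \<in> insert p lam" and eg: "(e, g) \<notin> insert p lam"
  have up_idx: "ladder_index l (e, g) = Suc (ladder_index l (e - 1, g))"
    using ladder_index_Suc_row[of l "e - 1" g] ce by simp
  \<comment> \<open>A violation must involve the new box, either as the end \<open>(c, y)\<close> of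
    the upper row or as the box \<open>(e - 1, g)\<close> above the gap.\<close>
  have not_both: "\<not> ((c, y) \<in> lam \<and> (e - 1, g) \<in> lam)"
    using lockedD[OF locked _ _ idx ce g] cy(2) eg by blast
  show False
  proof (cases "(c, y) = p")
    case True
    then have c: "c = a" "y = b" by (simp_all add: ab)
    have "(e - 1, g) \<noteq> p" using up_idx idx True by auto
    then have up': "(e - 1, g) \<in> lam" using up by simp
    have "g < b" using ladder_above_right[of l a b e g] idx ce c by simp
    \<comment> \<open>As \<open>p\<close> is the lowest addable box of its ladder, the left
      neighbour of \<open>(e, g)\<close> is missing. One column to the left this gives a violation
      already in \<open>lam\<close>.\<close>
    have "\<not> addable lam (e, g)"
      using bottom[of "(e, g)"] idx True ce c by (auto simp: ab)
    then have gn: "g \<noteq> 1" "(e, g - 1) \<notin> lam"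
      using addable_iff[OF lam, of e g] eg up' g ce by auto
    have up'': "(e - 1, g - 1) \<in> lam"
    proof (rule partition_mono[OF lam up'])
      show "1 \<le> g - 1" using g gn(1) by linarith
    qed (use partition_posD[OF lam up'] in simp_all)
    have "ladder_index l (e, g - 1) = ladder_index l (a, b - 1)"
      using ladder_index_Suc_column[of "g - 1" l e] ladder_index_Suc_column[of "b - 1" l a]
        idx c g gn(1) \<open>g < b\<close> by simp
    moreover have "(a, b - 1) \<in> lam" "(a, Suc (b - 1)) \<notin> lam" using A \<open>g < b\<close> g by auto
    ultimately show False
      using lockedD[OF locked, of a "b - 1" e "g - 1"] up'' gn g ce c by simp
  next
    case False
    then have cy': "(c, y) \<in> lam" "(c, Suc y) \<notin> lam" using cy by auto
    then have "(e - 1, g) = p" using not_both up by blast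
    then have e: "e = Suc a" "g = b" using ce by (auto simp: ab)
    have idx': "ladder_index l (c, y) = Suc (ladder_index l (a, b))"
      using idx e ladder_index_Suc_row[of l a b] by simp
    have pos: "1 \<le> c" "1 \<le> y" using partition_posD[OF lam cy'(1)] by auto
    \<comment> \<open>Indices in one row differ by multiples of \<open>l - 1\<close>, and
      \<open>3 \<le> l\<close> excludes the difference 1.\<close>
    have "c \<noteq> a"
    proof
      assume "c = a"
      then show False
        using idx' ladder_index_column_less[of b y l a] ladder_index_column_less[of y b l a] pos A l
        by (cases y b rule: linorder_cases) auto
    qed
    then have ca: "c < a" using ce e by simp
    then have up_a: "(a - 1, b) \<in> lam" using A pos by auto
    \<comment> \<open>The empty position \<open>(a, b)\<close> has a box above it, so no row above
      \<open>a\<close> ends on its ladder.\<close>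
    have end_above: False
      if "(e', y') \<in> lam" "(e', Suc y') \<notin> lam" "e' < a"
        "ladder_index l (e', y') = ladder_index l (a, b)" for e' y'
      using lockedD[OF locked that(1,2) that(4)[symmetric] that(3) A(3) up_a] A(1) by simp
    have "(c - 1, Suc y) \<in> lam" if "c \<noteq> 1"
    proof (rule ccontr)
      assume n: "(c - 1, Suc y) \<notin> lam"
      have "(c - 1, y) \<in> lam"
        using partition_mono[OF lam cy'(1), of "c - 1" y] pos that by simp
      moreover have "ladder_index l (c - 1, y) = ladder_index l (a, b)"
        using idx' ladder_index_Suc_row[of l "c - 1" y] pos by simp
      moreover have "c - 1 < a" using ca by linarith
      ultimately show False using end_above[of "c - 1" y] n by blast
    qed
    then have "addable lam (c, Suc y)"
      using addable_iff[OF lam, of c "Suc y"] cy' pos by auto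
    moreover have "ladder_index l (c, Suc y) = ladder_index l p + l"
      using ladder_index_Suc_column[OF pos(2), of l c] idx' l by (simp add: ab)
    ultimately have "ladder_removables l lam (ladder_index l p) \<noteq> {}"
      using next_ladder by (auto simp: ladder_addables_def)
    then obtain e' g' where r: "removable lam (e', g')"
        "ladder_index l (e', g') = ladder_index l (a, b)"
      by (auto simp: ladder_removables_def ab)
    then have r': "(e', g') \<in> lam" "(Suc e', g') \<notin> lam" "(e', Suc g') \<notin> lam"
      using removable_iff[OF lam, of e' g'] by auto
    \<comment> \<open>So the removable box lies in row \<open>a\<close> or below. The empty position
      under it is on the ladder of \<open>(c, y)\<close> and contradicts \<open>locked\<close> for
      \<open>lam\<close>.\<close>
    have "c < Suc e'"
    proof (rule ccontr)
      assume "\<not> c < Suc e'"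
      then have "e' < a" using ca by linarith
      then show False using end_above[OF r'(1,3) _ r(2)] by blast
    qed
    moreover have "ladder_index l (Suc e', g') = ladder_index l (c, y)"
      using ladder_index_Suc_row[of l e' g'] r(2) idx' by simp
    ultimately show False
      using lockedD[OF locked cy', of "Suc e'" g'] r' partition_posD[OF lam r'(1)] by simp
  qed
qed

text \<open>
  The idea for uniqueness: let \<open>(c, y)\<close> be the end of the first row where the diagrams differ. On
  its ladder below row \<open>c\<close> the diagram \<open>nu\<close> must have one more box than \<open>lam\<close>. Each of these has
  a box above it, on the preceding ladder, where the diagrams have equally many boxes from row \<open>c\<close>
  on; and \<open>lam\<close>, being locked, has a box below each of its boxes there.
\<close>

lemma locked_row_unique:
  assumes lam: "is_partition lam" and nu: "is_partition nu" and locked: "locked l lam"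
    and l: "2 \<le> l" and content: "content l lam = content l nu"
    and rows: "\<And>a b. a < c \<Longrightarrow> (a, b) \<in> lam \<longleftrightarrow> (a, b) \<in> nu"
    and y0: "(c, y0) \<in> lam" "(c, y0) \<notin> nu"
  shows False
proof -
  have fin: "finite {b. (c, b) \<in> lam}"
    by (rule finite_subset[of _ "snd ` lam"]) (use partition_finite[OF lam] in force)+
  define y where "y = Max {b. (c, b) \<in> lam}"
  have "y \<in> {b. (c, b) \<in> lam}" unfolding y_def using fin y0(1) by (intro Max_in) auto
  then have cy: "(c, y) \<in> lam" by simp
  have "y0 \<le> y" unfolding y_def using fin y0(1) by (intro Max_ge) auto
  have "(c, Suc y) \<notin> lam"
  proof
    assume "(c, Suc y) \<in> lam"
    then have "Suc y \<le> y" unfolding y_def using fin by (intro Max_ge) auto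
    then show False by simp
  qed
  have pos: "1 \<le> c" "1 \<le> y" using partition_posD[OF lam cy] by auto
  have "(c, y) \<notin> nu"
    using partition_mono[OF nu, of c y c y0] y0(2) \<open>y0 \<le> y\<close> pos partition_posD[OF lam y0(1)]
    by blast
  define m where "m = ladder_index l (c, y)"
  let ?B = "\<lambda>k X. {z \<in> X. ladder_index l z = k \<and> fst z < c}"
  let ?P = "\<lambda>X. {z \<in> X. ladder_index l z = m \<and> c < fst z}"
  let ?U = "\<lambda>X. {z \<in> X. ladder_index l z = m - 1 \<and> c \<le> fst z}"
  have B: "?B k lam = ?B k nu" for k using rows by auto
  have split_U: "content l X (m - 1) = card (?B (m - 1) X) + card (?U X)" if "finite X" for X
  proof -
    have "{z \<in> X. ladder_index l z = m - 1} = ?B (m - 1) X \<union> ?U X" by auto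
    then show ?thesis unfolding content_def
      using that by (simp only:) (intro card_Un_disjoint, auto)
  qed
  have U: "card (?U lam) = card (?U nu)"
    using split_U[OF partition_finite[OF lam]] split_U[OF partition_finite[OF nu]] B
      fun_cong[OF content, of "m - 1"] by simp
  have row_c: "z = (c, y)" if "z \<in> positions" "ladder_index l z = m" "fst z = c" for z
    using that ladder_same_row[OF l, of "snd z" y c] pos
    by (cases z) (auto simp: m_def positions_def)
  have "z \<in> ?B m lam \<union> insert (c, y) (?P lam)" if "z \<in> lam" "ladder_index l z = m" for z
  proof (cases "fst z = c")
    case True
    then show ?thesis using row_c[of z] that partition_subset[OF lam] by auto
  qed (use that in auto)
  then have "{z \<in> lam. ladder_index l z = m} = ?B m lam \<union> insert (c, y) (?P lam)"
    using cy m_def by auto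
  moreover have "card (?B m lam \<union> insert (c, y) (?P lam)) = card (?B m lam) + Suc (card (?P lam))"
    using partition_finite[OF lam] by (subst card_Un_disjoint) auto
  moreover have "{z \<in> nu. ladder_index l z = m} = ?B m nu \<union> ?P nu"
  proof -
    have "fst z \<noteq> c" if "z \<in> nu" "ladder_index l z = m" for z
      using row_c[of z] that partition_subset[OF nu] \<open>(c, y) \<notin> nu\<close> by auto
    then show ?thesis by (fastforce simp: linorder_neq_iff)
  qed
  moreover have "card (?B m nu \<union> ?P nu) = card (?B m nu) + card (?P nu)"
    using partition_finite[OF nu] by (subst card_Un_disjoint) auto
  ultimately have P: "card (?P nu) = Suc (card (?P lam))"
    using fun_cong[OF content, of m] B[of m] by (simp add: content_def)
  have "card (?P nu) \<le> card (?U nu)"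
  proof (rule card_inj_on_le[where f = "\<lambda>z. (fst z - 1, snd z)"])
    show "inj_on (\<lambda>z. (fst z - 1, snd z)) (?P nu)" by (rule inj_onI) auto
    show "(\<lambda>z. (fst z - 1, snd z)) ` ?P nu \<subseteq> ?U nu"
    proof (rule image_subsetI)
      fix z assume "z \<in> ?P nu"
      then obtain a b where z: "z = (a, b)" "(a, b) \<in> nu" "ladder_index l (a, b) = m" "c < a"
        by (cases z) auto
      have "1 \<le> a - 1" using z(4) pos by linarith
      moreover from this have "(a - 1, b) \<in> nu"
        by (rule partition_mono[OF nu z(2)]) (use partition_posD[OF nu z(2)] in simp_all)
      ultimately show "(fst z - 1, snd z) \<in> ?U nu"
        using z ladder_index_Suc_row[of l "a - 1" b] by auto
    qed
    show "finite (?U nu)" using partition_finite[OF nu] by simp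
  qed
  moreover have "card (?U lam) \<le> card (?P lam)"
  proof (rule card_inj_on_le[where f = "\<lambda>z. (Suc (fst z), snd z)"])
    show "inj_on (\<lambda>z. (Suc (fst z), snd z)) (?U lam)" by (rule inj_onI) auto
    show "(\<lambda>z. (Suc (fst z), snd z)) ` ?U lam \<subseteq> ?P lam"
    proof (rule image_subsetI)
      fix z assume "z \<in> ?U lam"
      then obtain a b where z: "z = (a, b)" "(a, b) \<in> lam" "ladder_index l (a, b) = m - 1" "c \<le> a"
        by (cases z) auto
      have "1 \<le> m" using pos by (simp add: m_def ladder_index_def)
      then have "ladder_index l (Suc a, b) = ladder_index l (c, y)"
        using ladder_index_Suc_row[of l a b] z(3) by (simp add: m_def)
      then show "(Suc (fst z), snd z) \<in> ?P lam"
        using lockedD[OF locked cy \<open>(c, Suc y) \<notin> lam\<close>, of "Suc a" b] z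
          partition_posD[OF lam z(2)] by (simp add: m_def)
    qed
    show "finite (?P lam)" using partition_finite[OF lam] by simp
  qed
  ultimately show False using P U by linarith
qed

lemma locked_unique:
  assumes lam: "is_partition lam" "locked l lam" and nu: "is_partition nu" "locked l nu"
    and l: "2 \<le> l" and content: "content l lam = content l nu"
  shows "lam = nu"
proof -
  have "\<forall>b. (c, b) \<in> lam \<longleftrightarrow> (c, b) \<in> nu" for c
  proof (induction c rule: less_induct)
    case (less c)
    have rows: "(a, b) \<in> lam \<longleftrightarrow> (a, b) \<in> nu" if "a < c" for a b
      using less[OF that] by blast
    show ?case
      using locked_row_unique[OF lam(1) nu(1) lam(2) l content rows]
        locked_row_unique[OF nu(1) lam(1) nu(2) l content[symmetric] rows[symmetric]] by blast
  qed
  then show ?thesis by auto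
qed


section \<open>The two operators agree up to regularization\<close>

lemma content_height:
  assumes "is_partition lam" "is_partition mu" "2 \<le> l" "content l mu = content l lam"
    and "ladder_residue l m = i" "1 \<le> m"
  shows "height l i lam m = height l i mu m"
  using height_content[OF assms(1-3), of 0 m i m] assms(4-) by simp

lemma ladder_residue_positions:
  "2 \<le> l \<Longrightarrow> p \<in> positions \<Longrightarrow> residue l p = i \<Longrightarrow>
    ladder_residue l (ladder_index l p) = i \<and> 1 \<le> ladder_index l p"
  using residue_ladder[of l p] ladder_index_pos[of p l] by simp

text \<open>The future graph of the isomorphism. Contents determine each side from the other;
  reachability is deliberately absent and proved afterwards.\<close>

definition ladder_related :: "nat \<Rightarrow> pos set \<Rightarrow> pos set \<Rightarrow> bool" where
  "ladder_related l mu lam \<longleftrightarrow> is_partition mu \<and> top_justified l mu \<and>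
     is_partition lam \<and> locked l lam \<and> content l mu = content l lam"

lemma related_None_iff:
  assumes l: "2 \<le> l" and rel: "ladder_related l mu lam"
  shows "f_tilde l i mu = None \<longleftrightarrow> f_hat l i lam = None"
proof -
  have mu: "is_partition mu" "top_justified l mu" and lam: "is_partition lam" "locked l lam"
    and content: "content l mu = content l lam"
    using rel by (auto simp: ladder_related_def)
  note height = content_height[OF lam(1) mu(1) l content]
  show ?thesis
  proof
    assume N: "f_tilde l i mu = None"
    show "f_hat l i lam = None"
    proof (rule ccontr)
      assume "f_hat l i lam \<noteq> None"
      then obtain lam' where "f_hat l i lam = Some lam'" by auto
      then obtain p where p: "addable lam p" "residue l p = i"
          "0 < height l i lam (ladder_index l p)"
        using f_hat_SomeE[OF lam l] by metis
      then show False
        using f_tilde_NoneD[OF mu l N, of "ladder_index l p"] height[of "ladder_index l p" i]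
          ladder_residue_positions[OF l addable_positions[OF p(1)] p(2)] by simp
    qed
  next
    assume N: "f_hat l i lam = None"
    show "f_tilde l i mu = None"
    proof (rule ccontr)
      assume "f_tilde l i mu \<noteq> None"
      then obtain mu' where "f_tilde l i mu = Some mu'" by auto
      then obtain p where p: "addable mu p" "residue l p = i"
          "0 < height l i mu (ladder_index l p)"
        using f_tilde_SomeE[OF mu l] by metis
      then show False
        using f_hat_NoneD[OF lam l N, of "ladder_index l p"] height[of "ladder_index l p" i]
          ladder_residue_positions[OF l addable_positions[OF p(1)] p(2)] by simp
    qed
  qed
qed

lemma related_Some:
  assumes l: "3 \<le> l" and rel: "ladder_related l mu lam"
    and f: "f_tilde l i mu = Some mu'" "f_hat l i lam = Some lam'"
  shows "ladder_related l mu' lam'"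
proof -
  have l2: "2 \<le> l" using l by simp
  have mu: "is_partition mu" "top_justified l mu" and lam: "is_partition lam" "locked l lam"
    and content: "content l mu = content l lam"
    using rel by (auto simp: ladder_related_def)
  note height = content_height[OF lam(1) mu(1) l2 content]
  obtain p where p: "mu' = insert p mu" "addable mu p" "residue l p = i"
    "\<And>m. height l i mu m \<le> height l i mu (ladder_index l p)"
    "\<And>m. m < ladder_index l p \<Longrightarrow> height l i mu m < height l i mu (ladder_index l p)"
    "\<And>q. addable mu q \<Longrightarrow> ladder_index l q = ladder_index l p \<Longrightarrow> fst p \<le> fst q"
    using f_tilde_SomeE[OF mu l2 f(1)] by metis
  obtain q where q: "lam' = insert q lam" "addable lam q" "residue l q = i"
    "\<And>m. height l i lam m \<le> height l i lam (ladder_index l q)"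
    "\<And>m. m < ladder_index l q \<Longrightarrow> height l i lam m < height l i lam (ladder_index l q)"
    "\<And>r. addable lam r \<Longrightarrow> ladder_index l r = ladder_index l q \<Longrightarrow> fst r \<le> fst q"
    using f_hat_SomeE[OF lam l2 f(2)] by metis
  let ?m = "ladder_index l p" and ?n = "ladder_index l q"
  have i: "ladder_residue l ?m = i" "1 \<le> ?m" "ladder_residue l ?n = i" "1 \<le> ?n"
    using ladder_residue_positions[OF l2 addable_positions] p(2,3) q(2,3) by auto
  have eq: "?m = ?n"
    using p(4)[of ?n] p(5)[of ?n] q(4)[of ?m] q(5)[of ?m] height[OF i(1,2)] height[OF i(3,4)]
    by (cases ?m ?n rule: linorder_cases) auto
  \<comment> \<open>Otherwise the height on the next ladder of residue \<open>i\<close> would exceed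
    the maximum.\<close>
  have "ladder_addables l lam (?n + l) \<noteq> {} \<Longrightarrow> ladder_removables l lam ?n \<noteq> {}"
  proof
    assume ne: "ladder_addables l lam (?n + l) \<noteq> {}" "ladder_removables l lam ?n = {}"
    have "finite (ladder_addables l lam (?n + l))"
      unfolding ladder_addables_def by (rule finite_addable[OF lam(1)])
    then have "0 < card (ladder_addables l lam (?n + l))" using ne by (simp add: card_gt_0_iff)
    moreover have "ladder_residue l (?n + l) = i"
      using i(3) ladder_residue_eq_iff[of l "?n + l" ?n] l by simp
    ultimately show False
      using height_step[OF lam(1) l2, of "?n + l" i] q(4)[of "?n + l"] i(4) ne(2) by simp
  qed
  then have "locked l lam'"
    using locked_insert[OF lam l q(2,6)] q(1) by blast
  moreover have "top_justified l mu'"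
    using top_justified_insert[OF mu l2 p(2,6)] p(1) by blast
  moreover have "content l mu' = content l lam'"
    using content_insert[OF partition_finite[OF mu(1)], of p l]
      content_insert[OF partition_finite[OF lam(1)], of q l] p(1,2) q(1,2) content eq
    by (auto simp: addable_def)
  ultimately show ?thesis
    using p(1,2) q(1,2) addable_partition by (auto simp: ladder_related_def)
qed


section \<open>Every regular partition is reached\<close>

lemma finite_last_argmax:
  fixes h :: "nat \<Rightarrow> int"
  assumes "finite I" "I \<noteq> {}"
  obtains m where "m \<in> I" "\<And>t. t \<in> I \<Longrightarrow> h t \<le> h m" "\<And>t. t \<in> I \<Longrightarrow> m < t \<Longrightarrow> h t < h m"
proof -
  define J where "J = {t \<in> I. h t = Max (h ` I)}"
  have "Max (h ` I) \<in> h ` I" using assms by (intro Max_in) auto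
  then have J: "finite J" "J \<noteq> {}" using assms(1) by (auto simp: J_def)
  have mJ: "Max J \<in> J" using Max_in[OF J] .
  have le: "h t \<le> h (Max J)" if "t \<in> I" for t
    using mJ that assms by (simp add: J_def)
  have "h t < h (Max J)" if "t \<in> I" "Max J < t" for t
  proof -
    have "t \<notin> J" using Max_ge[OF J(1)] that(2) by (meson leD)
    then have "h t \<noteq> h (Max J)" using that(1) mJ by (simp add: J_def)
    then show ?thesis using le[OF that(1)] by simp
  qed
  with that[of "Max J"] le mJ show thesis by (simp add: J_def)
qed

text \<open>Beyond the box of maximal index there are no letters of its residue.\<close>

lemma height_beyond:
  assumes mu: "is_partition mu" and l: "2 \<le> l" and x: "x \<in> mu"
    and max: "\<And>z. z \<in> mu \<Longrightarrow> ladder_index l z \<le> ladder_index l x"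
    and t: "ladder_index l x < t"
  shows "height l (residue l x) mu t < height l (residue l x) mu (ladder_index l x)"
proof -
  let ?M = "ladder_index l x" and ?i = "residue l x"
  obtain a b where ab: "x = (a, b)" by force
  have pos: "1 \<le> a" "1 \<le> b" using partition_posD[OF mu] x ab by auto
  have "(Suc a, b) \<notin> mu"
    using max[of "(Suc a, b)"] ladder_index_Suc_row[of l a b] by (auto simp: ab)
  moreover have "(a, Suc b) \<notin> mu"
    using max[of "(a, Suc b)"] ladder_index_Suc_column[OF pos(2), of l a] l by (auto simp: ab)
  ultimately have rem: "removable mu x" using removable_iff[OF mu, of a b] x ab by simp
  \<comment> \<open>A neighbour in \<open>mu\<close> above or to the left would bound the index by
    \<open>ladder_index l x + (l - 1)\<close>, while equal residues demand a gap of
    \<open>l\<close>. Only \<open>(1, 1)\<close> has no such neighbour, and its index is 1.\<close>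
  have low: "ladder_index l q \<le> ?M" if q: "addable mu q" "residue l q = ?i" for q
  proof (rule ccontr)
    assume n: "\<not> ?thesis"
    obtain c d where cd: "q = (c, d)" by force
    have add: "1 \<le> c" "1 \<le> d" "c = 1 \<or> (c - 1, d) \<in> mu" "d = 1 \<or> (c, d - 1) \<in> mu"
      using q addable_iff[OF mu, of c d] by (auto simp: cd)
    have "x \<in> positions" using x partition_subset[OF mu] by blast
    then have "ladder_index l q mod l = ?M mod l"
      using q(2) residue_ladder[of l] addable_positions[OF q(1)] l
        ladder_residue_eq_iff[of l "ladder_index l q" ?M] by simp
    then have "l dvd ladder_index l q - ?M"
      using n by (subst mod_eq_dvd_iff_nat[symmetric]) auto
    then have gap: "l \<le> ladder_index l q - ?M" using n by (intro dvd_imp_le) auto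
    have "c = 1"
    proof (rule ccontr)
      assume "c \<noteq> 1"
      then have "ladder_index l (c - 1, d) \<le> ?M" using add max by blast
      then show False using ladder_index_Suc_row[of l "c - 1" d] add(1) gap l n by (simp add: cd)
    qed
    moreover have "d = 1"
    proof (rule ccontr)
      assume "d \<noteq> 1"
      then have "ladder_index l (c, d - 1) \<le> ?M" "1 \<le> d - 1" using add max by auto
      then show False
        using ladder_index_Suc_column[of "d - 1" l c] add(2) gap l n by (simp add: cd)
    qed
    moreover have "1 \<le> ?M" using pos by (simp add: ab ladder_index_def)
    ultimately show False using n by (simp add: cd ladder_index_def)
  qed
  have "{p. addable mu p \<and> residue l p = ?i \<and> ladder_index l p \<le> t} =
      {p. addable mu p \<and> residue l p = ?i \<and> ladder_index l p \<le> ?M}"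
    using low t by fastforce
  moreover have "{p. removable mu p \<and> residue l p = ?i \<and> ladder_index l p < ?M} \<subset>
      {p. removable mu p \<and> residue l p = ?i \<and> ladder_index l p < t}"
    using rem t by auto
  then have "card {p. removable mu p \<and> residue l p = ?i \<and> ladder_index l p < ?M} <
      card {p. removable mu p \<and> residue l p = ?i \<and> ladder_index l p < t}"
    by (rule psubset_card_mono[OF finite_removable[OF mu]])
  ultimately show ?thesis unfolding height_def by simp
qed

text \<open>The removable box given need not be the right one; the lowest box of its ladder is. A
  box below or to the right of that would force one at the same side of the given box.\<close>

lemma top_justified_remove:
  assumes mu: "is_partition mu" and top: "top_justified l mu" and l: "2 \<le> l"
    and ne: "ladder_removables l mu m \<noteq> {}"
  obtains x where "x \<in> mu" "ladder_index l x = m" "is_partition (mu - {x})"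
    "top_justified l (mu - {x})"
proof -
  obtain e g where r: "removable mu (e, g)" "ladder_index l (e, g) = m"
    using ne by (auto simp: ladder_removables_def)
  have eg: "(e, g) \<in> mu" "(Suc e, g) \<notin> mu" "(e, Suc g) \<notin> mu"
    using r removable_iff[OF mu, of e g] by auto
  let ?R = "fst ` {z \<in> mu. ladder_index l z = m}"
  have R: "finite ?R" "e \<in> ?R"
  proof -
    show "finite ?R" using partition_finite[OF mu] by simp
    show "e \<in> ?R" using eg(1) r(2) by force
  qed
  define a where "a = Max ?R"
  have "a \<in> ?R" unfolding a_def using R by (intro Max_in) auto
  then obtain b where ab: "(a, b) \<in> mu" "ladder_index l (a, b) = m" by auto
  have low: "c \<le> a" if "(c, d) \<in> mu" "ladder_index l (c, d) = m" for c d
  proof -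
    have "c \<in> ?R" using that by force
    then show ?thesis unfolding a_def by (rule Max_ge[OF R(1)])
  qed
  have ea: "e \<le> a" using low eg(1) r(2) by blast
  have pos: "1 \<le> a" "1 \<le> b" "1 \<le> e" "1 \<le> g"
    using partition_posD[OF mu] ab(1) eg(1) by auto
  have down: "(Suc a, b) \<notin> mu"
    using top_justifiedD[OF top, of "Suc a" b "Suc e" g] eg(2) ea pos ab(2) r(2)
    by (auto simp: ladder_index_Suc_row)
  have right: "(a, Suc b) \<notin> mu"
    using top_justifiedD[OF top, of a "Suc b" e "Suc g"] eg(3) ea pos ab(2) r(2)
    by (auto simp: ladder_index_Suc_column)
  have "top_justified l (mu - {(a, b)})"
    unfolding top_justified_def
  proof (intro allI impI)
    fix a' b' c d
    assume *: "(a', b') \<in> mu - {(a, b)}" "1 \<le> c" "1 \<le> d" "c \<le> a'"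
      "ladder_index l (c, d) \<le> ladder_index l (a', b')"
    have "(c, d) \<noteq> (a, b)"
    proof
      assume cd: "(c, d) = (a, b)"
      have b': "1 \<le> b'" using partition_posD[OF mu, of a' b'] *(1) by simp
      show False
      proof (cases "a' = a")
        case True
        then have "b < b'"
          using * cd pos b' l ladder_index_column_less[of b' b l a]
          by (cases b b' rule: linorder_cases) auto
        then show False
          using partition_mono[OF mu, of a' b' a "Suc b"] * True right pos by simp
      next
        case False
        then have "a < a'" using * cd by simp
        then have "ladder_index l (a', b') \<noteq> m" using low[of a' b'] * by auto
        then have "ladder_index l (Suc a, b) \<le> ladder_index l (a', b')"
          using * cd ab(2) ladder_index_Suc_row[of l a b] by simp
        then show False
          using top_justifiedD[OF top, of a' b' "Suc a" b] * \<open>a < a'\<close> down pos by simp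
      qed
    qed
    moreover have "(c, d) \<in> mu" using top_justifiedD[OF top _ *(2-5)] *(1) by simp
    ultimately show "(c, d) \<in> mu - {(a, b)}" by simp
  qed
  moreover have "is_partition (mu - {(a, b)})"
    using removable_iff[OF mu, of a b] ab(1) down right by (simp add: removable_def)
  ultimately show thesis using that[of "(a, b)"] ab by blast
qed

text \<open>The box removed is the lowest one on the last ladder where the height is maximal. Removing it
  raises the height by 1 there and by 2 afterwards, which makes this ladder the first maximum.\<close>

lemma f_tilde_predecessor:
  assumes mu: "is_partition mu" and top: "top_justified l mu" and l: "2 \<le> l" and ne: "mu \<noteq> {}"
  obtains i nu where "i < l" "is_partition nu" "top_justified l nu" "f_tilde l i nu = Some mu"
    "nu \<subset> mu"
proof -
  have fin: "finite mu" using partition_finite[OF mu] .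
  define M where "M = Max (ladder_index l ` mu)"
  have "M \<in> ladder_index l ` mu" unfolding M_def using fin ne by (intro Max_in) auto
  then obtain x0 where x0: "x0 \<in> mu" "ladder_index l x0 = M" by auto
  have max: "ladder_index l z \<le> ladder_index l x0" if "z \<in> mu" for z
    unfolding x0(2) M_def using fin that by (intro Max_ge) auto
  define i where "i = residue l x0"
  have "nat (k mod int l) < l" for k using l by (subst nat_less_iff) auto
  then have il: "i < l" by (cases x0) (simp add: i_def residue_def)
  have x0_pos: "x0 \<in> positions" using x0(1) partition_subset[OF mu] by blast
  have M: "ladder_residue l M = i" "1 \<le> M"
    using ladder_residue_positions[OF l x0_pos, of i] x0(2) by (auto simp: i_def)
  define I where "I = {t. 1 \<le> t \<and> t \<le> M \<and> ladder_residue l t = i}"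
  have I: "finite I" "I \<noteq> {}" using M by (auto simp: I_def)
  obtain m where m: "m \<in> I" "\<And>t. t \<in> I \<Longrightarrow> height l i mu t \<le> height l i mu m"
      "\<And>t. t \<in> I \<Longrightarrow> m < t \<Longrightarrow> height l i mu t < height l i mu m"
    using finite_last_argmax[OF I, of "height l i mu"] by metis
  have mi: "1 \<le> m" "m \<le> M" "ladder_residue l m = i" using m(1) by (auto simp: I_def)
  have beyond: "height l i mu t < height l i mu m" if "M < t" for t
    using height_beyond[OF mu l x0(1) max, of t] that m(2)[of M] M x0(2)
    by (simp add: i_def I_def)
  have le: "height l i mu t \<le> height l i mu m" if "ladder_residue l t = i" "1 \<le> t" for t
    using m(2)[of t] beyond[of t] that by (cases "t \<le> M") (auto simp: I_def)
  have less: "height l i mu t < height l i mu m" if "ladder_residue l t = i" "m < t" for t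
    using m(3)[of t] beyond[of t] that by (cases "t \<le> M") (auto simp: I_def)
  \<comment> \<open>No minus precedes the first ladder of residue \<open>i\<close>. After the
    removal the maximum is therefore positive, so \<open>f_tilde\<close> is defined.\<close>
  have nonneg: "0 \<le> height l i mu m"
  proof -
    let ?t = "Min I"
    have t: "?t \<in> I" using Min_in[OF I] .
    have "?t \<le> l"
    proof (rule ccontr)
      assume n: "\<not> ?t \<le> l"
      then have "ladder_residue l (?t - l) = ladder_residue l ?t"
        using ladder_residue_eq_iff[of l "?t - l" ?t] le_mod_geq[of l ?t] l by simp
      then have "?t - l \<in> I" using t n by (auto simp: I_def)
      then have "?t \<le> ?t - l" by (rule Min_le[OF I(1)])
      then show False using n l by linarith
    qed
    moreover have "ladder_removables l mu 0 = {}"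
    proof -
      have "ladder_index l p \<noteq> 0" if "removable mu p" for p
        using ladder_index_pos[OF removable_positions[OF mu that], of l] by simp
      then show ?thesis by (auto simp: ladder_removables_def)
    qed
    ultimately have "0 \<le> height l i mu ?t"
      using height_step[OF mu l, of ?t i] t height_zero[OF mu, of l i] by (simp add: I_def)
    then show ?thesis using m(2)[OF t] by simp
  qed
  \<comment> \<open>Without a minus on ladder \<open>m\<close>, the height could not drop on the way
    to ladder \<open>m + l\<close>, so \<open>m\<close> would not be the last maximum.\<close>
  have "ladder_removables l mu m \<noteq> {}"
  proof
    assume "ladder_removables l mu m = {}"
    moreover have res: "ladder_residue l (m + l) = i"
      using mi(3) ladder_residue_eq_iff[of l "m + l" m] l by simp
    ultimately show False
      using height_step[OF mu l res] less[OF res] l mi(1) by simp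
  qed
  then obtain x where x: "x \<in> mu" "ladder_index l x = m" "is_partition (mu - {x})"
      "top_justified l (mu - {x})"
    using top_justified_remove[OF mu top l] by metis
  let ?nu = "mu - {x}"
  have content: "content l mu t = content l ?nu t + of_bool (ladder_index l x = t)" for t
    using content_insert[of ?nu x l t] fin x(1) by (simp add: insert_absorb)
  have height: "height l i ?nu t =
      height l i mu t + (of_bool (m \<le> t) + of_bool (m < t))"
    if "ladder_residue l t = i" "1 \<le> t" for t
    using height_content[OF x(3) mu l, of 1 m i t] content x(2) mi that by (simp add: eq_commute)
  have "f_tilde l i ?nu \<noteq> None"
    using f_tilde_NoneD[OF x(3,4) l, of i m] height[of m] mi nonneg by auto
  then obtain mu' where f: "f_tilde l i ?nu = Some mu'" by auto
  obtain p where p: "mu' = insert p ?nu" "addable ?nu p" "residue l p = i"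
    "\<And>m. height l i ?nu m \<le> height l i ?nu (ladder_index l p)"
    "\<And>m. m < ladder_index l p \<Longrightarrow> height l i ?nu m < height l i ?nu (ladder_index l p)"
    "\<And>q. addable ?nu q \<Longrightarrow> ladder_index l q = ladder_index l p \<Longrightarrow> fst p \<le> fst q"
    using f_tilde_SomeE[OF x(3,4) l f] by metis
  let ?n = "ladder_index l p"
  have n: "ladder_residue l ?n = i" "1 \<le> ?n"
    using ladder_residue_positions[OF l addable_positions[OF p(2)] p(3)] by auto
  \<comment> \<open>To the left of \<open>m\<close> nothing changes, so ladder \<open>m\<close> now
    exceeds everything there. To the right, heights were lower by at least 1 and gain 2 against 1,
    so they can tie at most.\<close>
  have "?n = m"
  proof (cases ?n m rule: linorder_cases)
    case less
    then show ?thesis using p(4)[of m] height[OF n] height[of m] le[OF n] mi by simp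
  next
    case greater
    then show ?thesis
      using p(5)[of m] height[OF n] height[of m] less[OF n(1)] mi by simp
  qed
  \<comment> \<open>The added box is not compared with \<open>x\<close>; equal contents and
    top-justification already give \<open>mu' = mu\<close>.\<close>
  then have "content l mu' t = content l mu t" for t
    using content_insert[of ?nu p l t] content[of t] p(1,2) fin x(2) by (simp add: addable_def)
  then have c: "content l mu' = content l mu" by blast
  have "is_partition mu'" "top_justified l mu'"
    using addable_partition[OF p(2)] top_justified_insert[OF x(3,4) l p(2,6)] p(1) by auto
  then have "mu' = mu"
    using top_justified_unique[OF _ _ mu top l c] top_justified_unique[OF mu top _ _ l c[symmetric]]
    by blast
  then show thesis
    using that[of i ?nu] il x f by blast
qed

section \<open>Weights and the bijection between the nodes\<close>

text \<open>The boxes of residue \<open>i\<close> are those on the ladders of residue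
  \<open>i\<close>, so the contents determine the weight; \<open>N\<close> makes the sum over
  ladders finite.\<close>

lemma related_weight:
  assumes l: "2 \<le> l" and rel: "ladder_related l mu lam"
  shows "partition_weight l lam = partition_weight l mu"
proof -
  have mu: "is_partition mu" and lam: "is_partition lam" and content: "content l mu = content l lam"
    using rel by (auto simp: ladder_related_def)
  obtain N where N: "\<And>z. z \<in> lam \<union> mu \<Longrightarrow> ladder_index l z \<le> N"
    using finite_nat_set_iff_bounded_le[of "ladder_index l ` (lam \<union> mu)"]
      partition_finite[OF mu] partition_finite[OF lam] by auto
  have count: "card {p \<in> X. residue l p = i} = (\<Sum>m | m \<le> N \<and> ladder_residue l m = i. content l X m)"
    if X: "is_partition X" "X \<subseteq> lam \<union> mu" for X i
  proof -
    have "{p \<in> X. residue l p = i} =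
        (\<Union>m\<in>{m. m \<le> N \<and> ladder_residue l m = i}. {z \<in> X. ladder_index l z = m})"
      using N X partition_subset[OF X(1)] residue_ladder[of l] l by fastforce
    then show ?thesis
      unfolding content_def using partition_finite[OF X(1)]
      by (simp only:) (rule card_UN_disjoint, auto)
  qed
  show ?thesis
    unfolding partition_weight_def
  proof (rule ext)
    fix x
    show "(case x of Lambda0 \<Rightarrow> 1
        | Alpha i \<Rightarrow> if i < l then - int (card {p \<in> lam. residue l p = i}) else 0) =
      (case x of Lambda0 \<Rightarrow> 1
        | Alpha i \<Rightarrow> if i < l then - int (card {p \<in> mu. residue l p = i}) else 0)"
      using count[OF mu] count[OF lam] content by (cases x) simp_all
  qed
qed

lemma ladder_node_related:
  assumes l: "3 \<le> l" and "lam \<in> ladder_nodes l"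
  shows "\<exists>mu. ladder_related l mu lam"
  using assms(2)
proof (induction rule: ladder_nodes.induct)
  case empty
  have "is_partition {}" by (simp add: is_partition_def)
  then show ?case
    by (intro exI[of _ "{}"]) (simp add: ladder_related_def top_justified_def locked_def)
next
  case (step lam i lam')
  then obtain mu where rel: "ladder_related l mu lam" by blast
  then obtain mu' where "f_tilde l i mu = Some mu'"
    using related_None_iff[OF _ rel, of i] step l by fastforce
  then show ?case using related_Some[OF l rel] step by blast
qed

text \<open>Induction along predecessors: the arrow from \<open>nu\<close> to \<open>mu\<close> is
  copied on the ladder side, starting from a node related to \<open>nu\<close>.\<close>

lemma top_justified_related:
  assumes l: "3 \<le> l" and "is_partition mu" "top_justified l mu"
  shows "\<exists>lam\<in>ladder_nodes l. ladder_related l mu lam"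
proof -
  have "finite mu" using assms(2) partition_finite by blast
  then show ?thesis
    using assms(2,3)
  proof (induction mu rule: finite_psubset_induct)
    case (psubset mu)
    show ?case
    proof (cases "mu = {}")
      case True
      then have "ladder_related l mu {}"
        using psubset.prems by (simp add: ladder_related_def locked_def)
      then show ?thesis using ladder_nodes.empty by blast
    next
      case False
      obtain i nu where nu: "i < l" "is_partition nu" "top_justified l nu"
          "f_tilde l i nu = Some mu" "nu \<subset> mu"
        by (rule f_tilde_predecessor[OF psubset.prems _ False]) (use l in simp)
      obtain lam where lam: "lam \<in> ladder_nodes l" "ladder_related l nu lam"
        using psubset.IH[OF nu(5,2,3)] by blast
      obtain lam' where "f_hat l i lam = Some lam'"
        using related_None_iff[OF _ lam(2), of i] nu(4) l by fastforce
      then show ?thesis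
        using related_Some[OF l lam(2) nu(4)] ladder_nodes.step[OF lam(1) nu(1)] by blast
    qed
  qed
qed

theorem corollary3p9p1p8:
  fixes l :: nat
  assumes "3 \<le> l"
  shows "crystals_isomorphic l (classical_crystal l) (ladder_crystal l)"
proof -
  have l: "2 \<le> l" using assms by simp
  have regular: "mu \<in> nodes (classical_crystal l) \<longleftrightarrow> is_partition mu \<and> top_justified l mu" for mu
    using regular_iff_top_justified[OF _ l, of mu]
    by (cases "is_partition mu") (simp_all add: classical_crystal_def)
  \<comment> \<open>The choice is immaterial: \<open>locked_unique\<close> leaves only one
    candidate.\<close>
  define \<phi> where "\<phi> mu = (SOME lam. lam \<in> ladder_nodes l \<and> ladder_related l mu lam)" for mu
  have \<phi>: "\<phi> mu \<in> ladder_nodes l \<and> ladder_related l mu (\<phi> mu)"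
    if "mu \<in> nodes (classical_crystal l)" for mu
  proof -
    have "\<exists>lam. lam \<in> ladder_nodes l \<and> ladder_related l mu lam"
      using top_justified_related[OF assms, of mu] that regular[of mu] by blast
    then show ?thesis unfolding \<phi>_def by (rule someI_ex)
  qed
  have unique: "lam = lam'" if "ladder_related l mu lam" "ladder_related l mu lam'" for mu lam lam'
    using locked_unique[of lam l lam'] that l by (simp add: ladder_related_def)
  have inj: "mu = mu'" if "ladder_related l mu lam" "ladder_related l mu' lam" for mu mu' lam
  proof -
    have mu: "is_partition mu" "top_justified l mu" and mu': "is_partition mu'" "top_justified l mu'"
      and content: "content l mu = content l mu'"
      using that by (simp_all add: ladder_related_def)
    show ?thesis
      using top_justified_unique[OF mu mu' l content]
        top_justified_unique[OF mu' mu l content[symmetric]] by (rule equalityI)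
  qed
  have node: "mu \<in> nodes (classical_crystal l)" if "ladder_related l mu lam" for mu lam
    using that regular by (simp add: ladder_related_def)
  have "bij_betw \<phi> (nodes (classical_crystal l)) (ladder_nodes l)"
    unfolding bij_betw_def
  proof
    show "inj_on \<phi> (nodes (classical_crystal l))"
    proof (rule inj_onI)
      fix mu mu'
      assume "mu \<in> nodes (classical_crystal l)" "mu' \<in> nodes (classical_crystal l)" "\<phi> mu = \<phi> mu'"
      then show "mu = mu'" using \<phi>[of mu] \<phi>[of mu'] inj[of mu "\<phi> mu" mu'] by simp
    qed
    have "lam \<in> \<phi> ` nodes (classical_crystal l)" if lam: "lam \<in> ladder_nodes l" for lam
    proof -
      obtain mu where mu: "ladder_related l mu lam"
        using ladder_node_related[OF assms lam] by blast
      show ?thesis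
      proof (rule image_eqI[of _ _ mu])
        show "mu \<in> nodes (classical_crystal l)" by (rule node[OF mu])
        then show "lam = \<phi> mu" using unique[OF mu] \<phi> by blast
      qed
    qed
    then show "\<phi> ` nodes (classical_crystal l) = ladder_nodes l" using \<phi> by blast
  qed
  moreover have "f_tilde l i x = Some y \<longleftrightarrow> f_hat l i (\<phi> x) = Some (\<phi> y)"
    if xy: "x \<in> nodes (classical_crystal l)" "y \<in> nodes (classical_crystal l)" for i x y
  proof
    assume f: "f_tilde l i x = Some y"
    then obtain lam where lam: "f_hat l i (\<phi> x) = Some lam"
      using related_None_iff[OF l, of x "\<phi> x" i] \<phi>[OF xy(1)] by auto
    then have "ladder_related l y lam" using related_Some[OF assms _ f] \<phi>[OF xy(1)] by blast
    then show "f_hat l i (\<phi> x) = Some (\<phi> y)" using unique \<phi>[OF xy(2)] lam by blast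
  next
    assume f: "f_hat l i (\<phi> x) = Some (\<phi> y)"
    then obtain mu where mu: "f_tilde l i x = Some mu"
      using related_None_iff[OF l, of x "\<phi> x" i] \<phi>[OF xy(1)] by auto
    then have "ladder_related l mu (\<phi> y)" using related_Some[OF assms _ mu f] \<phi>[OF xy(1)] by blast
    then show "f_tilde l i x = Some y" using inj \<phi>[OF xy(2)] mu by blast
  qed
  moreover have "partition_weight l (\<phi> x) = partition_weight l x"
    if "x \<in> nodes (classical_crystal l)" for x
    using related_weight[OF l] \<phi>[OF that] by blast
  ultimately show ?thesis
    unfolding crystals_isomorphic_def crystal_iso_def
    by (intro exI[of _ \<phi>]) (simp add: classical_crystal_def ladder_crystal_def)
qed

end
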